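(* Let $(M,g_{ab},F_{ab})$ be a stationary axisymmetric spacetime, with commuting Killing vector fields $k^a$ (stationary) and $m^a$ (axial), containing a Killing horizon $H[\chi]$ of the Killing vector field $\chi^a=k^a+\Omega_H m^a$ and a stationary axisymmetric electromagnetic field $F_{ab}$ ($\mathcal{L}_kF=\mathcal{L}_mF=0$), nonsingular on $H[\chi]$, which is a solution to Maxwell's equations $$\mathrm{d}F = 4\pi\,{*J_{\mathrm m}},\qquad \mathrm{d}{*F} = 4\pi\,{*J_{\mathrm e}}$$ with electric current $J_{\mathrm e}$ and magnetic current $J_{\mathrm m}$ which satisfy the conditions $$J_{\mathrm e}\wedge\chi = 0 \quad\text{and}\quad J_{\mathrm m}\wedge\chi = 0$$ on some open set $O\supset H[\chi]$. Then the electric scalar potential $\Phi$ and the magnetic scalar potential $\Psi$ are constant on each connected component of the Killing horizon $H[\chi]$.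
   Context: Spacetimes are 4-dimensional, connected smooth Lorentzian manifolds with signature $(-,+,+,+)$; no gravitational field equation is assumed. Vectors and 1-forms are identified via the metric, so $\chi$ in $J\wedge\chi$ is the 1-form $\chi_a$; $(\cdot|\cdot)$ is the metric inner product. The Hodge dual of a $p$-form is $( *\omega)_{a_{p+1}\cdots a_4}=\frac1{p!}\,\omega_{a_1\cdots a_p}\,\epsilon^{a_1\cdots a_p}{}_{a_{p+1}\cdots a_4}$, and $i_X$ is contraction of a vector $X^a$ with the first slot of a form. The axial Killing field $m^a$ has closed orbits, and the rotation axis is the set where $m^a$ vanishes. Put $X=(m|m)$ and $W=(k|m)$; closed causal curves are assumed absent in the exterior of the horizon, so that there $X\ge0$ with equality only on the rotation axis. A Killing horizon $H[\chi]$ is (roughly) a null hypersurface to which the Killing field $\chi^a$ is normal; $\Omega_H=-\frac{W}{X}\big|_H$ is the constant angular velocity of the horizon. The horizon is supposed to be invariant under the action of $k^a$ and $m^a$, i.e. these fields are tangent to it. The scalar potentials are those with respect to $\chi^a$: the current conditions make the 1-forms $E=-i_\chi F$ and $B=i_\chi{*F}$ closed, so that, at least locally, $E=\mathrm{d}\Phi$ and $B=\mathrm{d}\Psi$. *)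

theory Defs
  imports "HOL-Analysis.Analysis"
begin

section \<open>Smooth functions\<close>

fun Ck_on :: "nat \<Rightarrow> 'a::euclidean_space set \<Rightarrow> ('a \<Rightarrow> 'b::real_normed_vector) \<Rightarrow> bool" where
  "Ck_on 0 S f \<longleftrightarrow> continuous_on S f"
| "Ck_on (Suc n) S f \<longleftrightarrow> (\<forall>x\<in>S. f differentiable at x) \<and>
     (\<forall>b\<in>Basis. Ck_on n S (\<lambda>x. frechet_derivative f (at x) b))"

text \<open>Only used for open sets.\<close>
definition smooth_on :: "'a::euclidean_space set \<Rightarrow> ('a \<Rightarrow> 'b::real_normed_vector) \<Rightarrow> bool" where
  "smooth_on S f \<longleftrightarrow> (\<forall>n. Ck_on n S f)"

definition pd :: "4 \<Rightarrow> (real^4 \<Rightarrow> real) \<Rightarrow> real^4 \<Rightarrow> real" where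
  "pd i f x = frechet_derivative f (at x) (axis i 1)"

definition grad :: "(real^4 \<Rightarrow> real) \<Rightarrow> real^4 \<Rightarrow> real^4" where
  "grad f x = (\<chi> i. pd i f x)"

section \<open>Oriented smooth 4-manifolds\<close>

text \<open>The manifold is the whole type \<open>'m\<close>, whose class supplies the topology. A chart is a domain
  together with a coordinate map, whose values outside the domain are irrelevant.\<close>

type_synonym 'm chart = "'m set \<times> ('m \<Rightarrow> real^4)"

abbreviation cdom :: "'m chart \<Rightarrow> 'm set" where "cdom c \<equiv> fst c"
abbreviation cmap :: "'m chart \<Rightarrow> 'm \<Rightarrow> real^4" where "cmap c \<equiv> snd c"

definition cinv :: "'m chart \<Rightarrow> real^4 \<Rightarrow> 'm" where
  "cinv c = inv_into (cdom c) (cmap c)"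

definition cimg :: "'m chart \<Rightarrow> 'm set \<Rightarrow> (real^4) set" where
  "cimg c S = cmap c ` (cdom c \<inter> S)"

definition transition :: "'m chart \<Rightarrow> 'm chart \<Rightarrow> real^4 \<Rightarrow> real^4" where
  "transition c c' = cmap c' \<circ> cinv c"

abbreviation jac :: "'m chart \<Rightarrow> 'm chart \<Rightarrow> real^4 \<Rightarrow> real^4^4" where
  "jac c c' x \<equiv> jacobian (transition c c') (at x)"

definition oriented_atlas :: "'m::topological_space chart set \<Rightarrow> bool" where
  "oriented_atlas A \<longleftrightarrow>
     (\<Union>c\<in>A. cdom c) = UNIV \<and>
     (\<forall>c\<in>A. open (cdom c) \<and> open (cimg c UNIV) \<and>
            homeomorphism (cdom c) (cimg c UNIV) (cmap c) (cinv c)) \<and>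
     (\<forall>c\<in>A. \<forall>c'\<in>A. smooth_on (cimg c (cdom c')) (transition c c') \<and>
            (\<forall>x\<in>cimg c (cdom c'). det (jac c c' x) > 0))"

section \<open>Tensor fields\<close>

text \<open>A tensor field is given by its components in each chart, as functions of the coordinates,
  subject to the transformation law. Index positions are not part of the type: a vector field and
  a 1-form have the same type and differ in the transformation law. A scalar field is simply a
  function on \<open>'m\<close>.\<close>

type_synonym 'm field1 = "'m chart \<Rightarrow> real^4 \<Rightarrow> real^4"
type_synonym 'm field2 = "'m chart \<Rightarrow> real^4 \<Rightarrow> real^4^4"

definition vector_field :: "'m chart set \<Rightarrow> 'm set \<Rightarrow> 'm field1 \<Rightarrow> bool" where
  "vector_field A S v \<longleftrightarrow> (\<forall>c\<in>A. smooth_on (cimg c S) (v c)) \<and>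
     (\<forall>c\<in>A. \<forall>c'\<in>A. \<forall>x\<in>cimg c (cdom c' \<inter> S).
        v c' (transition c c' x) = jac c c' x *v v c x)"

definition one_form :: "'m chart set \<Rightarrow> 'm set \<Rightarrow> 'm field1 \<Rightarrow> bool" where
  "one_form A S w \<longleftrightarrow> (\<forall>c\<in>A. smooth_on (cimg c S) (w c)) \<and>
     (\<forall>c\<in>A. \<forall>c'\<in>A. \<forall>x\<in>cimg c (cdom c' \<inter> S).
        w c x = transpose (jac c c' x) *v w c' (transition c c' x))"

definition cov2_field :: "'m chart set \<Rightarrow> 'm set \<Rightarrow> 'm field2 \<Rightarrow> bool" where
  "cov2_field A S T \<longleftrightarrow> (\<forall>c\<in>A. smooth_on (cimg c S) (T c)) \<and>
     (\<forall>c\<in>A. \<forall>c'\<in>A. \<forall>x\<in>cimg c (cdom c' \<inter> S).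
        T c x = transpose (jac c c' x) ** T c' (transition c c' x) ** jac c c' x)"

definition two_form :: "'m chart set \<Rightarrow> 'm set \<Rightarrow> 'm field2 \<Rightarrow> bool" where
  "two_form A S F \<longleftrightarrow> cov2_field A S F \<and>
     (\<forall>c\<in>A. \<forall>x\<in>cimg c S. transpose (F c x) = - F c x)"

definition smooth_scalar :: "'m chart set \<Rightarrow> 'm set \<Rightarrow> ('m \<Rightarrow> real) \<Rightarrow> bool" where
  "smooth_scalar A S f \<longleftrightarrow> (\<forall>c\<in>A. smooth_on (cimg c S) (f \<circ> cinv c))"

section \<open>Lorentzian metrics and the Hodge dual\<close>

definition minkowski :: "real^4^4" where
  "minkowski = (\<chi> i j. if i \<noteq> j then 0 else if i = 1 then -1 else 1)"

definition lorentz_metric :: "'m chart set \<Rightarrow> 'm field2 \<Rightarrow> bool" where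
  "lorentz_metric A g \<longleftrightarrow> cov2_field A UNIV g \<and>
     (\<forall>c\<in>A. \<forall>x\<in>cimg c UNIV. transpose (g c x) = g c x \<and>
        (\<exists>P. invertible P \<and> transpose P ** g c x ** P = minkowski))"

definition ip :: "real^4^4 \<Rightarrow> real^4 \<Rightarrow> real^4 \<Rightarrow> real" where
  "ip G u v = (\<Sum>a\<in>UNIV. \<Sum>b\<in>UNIV. G $ a $ b * u $ a * v $ b)"

definition lower :: "real^4^4 \<Rightarrow> real^4 \<Rightarrow> real^4" where
  "lower G v = G *v v"

definition raise :: "real^4^4 \<Rightarrow> real^4 \<Rightarrow> real^4" where
  "raise G w = matrix_inv G *v w"

text \<open>The volume form \<open>\<epsilon>\<^sub>a\<^sub>b\<^sub>c\<^sub>d\<close> in a positively oriented chart. The determinant is the Levi-Civita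
  symbol; the coordinates are ordered \<open>1, 2, 3, 4\<close>, where \<open>4 = 0\<close> in the index type.\<close>
definition vol :: "real^4^4 \<Rightarrow> 4 \<Rightarrow> 4 \<Rightarrow> 4 \<Rightarrow> 4 \<Rightarrow> real" where
  "vol G a b c d =
     sqrt \<bar>det G\<bar> * det (vector [axis a 1, axis b 1, axis c 1, axis d 1] :: real^4^4)"

definition hodge1 :: "real^4^4 \<Rightarrow> real^4 \<Rightarrow> 4 \<Rightarrow> 4 \<Rightarrow> 4 \<Rightarrow> real" where
  "hodge1 G w b c d = (\<Sum>a\<in>UNIV. raise G w $ a * vol G a b c d)"

definition hodge2 :: "real^4^4 \<Rightarrow> real^4^4 \<Rightarrow> real^4^4" where
  "hodge2 G F = (\<chi> c d. 1/2 * (\<Sum>a\<in>UNIV. \<Sum>b\<in>UNIV.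
     (matrix_inv G ** F ** transpose (matrix_inv G)) $ a $ b * vol G a b c d))"

section \<open>Operations on forms and vector fields in coordinates\<close>

definition d2 :: "(real^4 \<Rightarrow> real^4^4) \<Rightarrow> real^4 \<Rightarrow> 4 \<Rightarrow> 4 \<Rightarrow> 4 \<Rightarrow> real" where
  "d2 F x a b c = pd a (\<lambda>y. F y $ b $ c) x + pd b (\<lambda>y. F y $ c $ a) x
     + pd c (\<lambda>y. F y $ a $ b) x"

definition contract2 :: "real^4 \<Rightarrow> real^4^4 \<Rightarrow> real^4" where
  "contract2 v F = (\<chi> b. \<Sum>a\<in>UNIV. v $ a * F $ a $ b)"

definition wedge11 :: "real^4 \<Rightarrow> real^4 \<Rightarrow> real^4^4" where
  "wedge11 u w = (\<chi> a b. u $ a * w $ b - u $ b * w $ a)"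

definition lie_bracket :: "(real^4 \<Rightarrow> real^4) \<Rightarrow> (real^4 \<Rightarrow> real^4) \<Rightarrow> real^4 \<Rightarrow> real^4" where
  "lie_bracket u v x = (\<chi> a. \<Sum>b\<in>UNIV.
     u x $ b * pd b (\<lambda>y. v y $ a) x - v x $ b * pd b (\<lambda>y. u y $ a) x)"

definition lie_cov2 :: "(real^4 \<Rightarrow> real^4) \<Rightarrow> (real^4 \<Rightarrow> real^4^4) \<Rightarrow> real^4 \<Rightarrow> real^4^4" where
  "lie_cov2 v T x = (\<chi> a b. \<Sum>c\<in>UNIV.
     v x $ c * pd c (\<lambda>y. T y $ a $ b) x
     + T x $ c $ b * pd a (\<lambda>y. v y $ c) x
     + T x $ a $ c * pd b (\<lambda>y. v y $ c) x)"

section \<open>Killing fields and their orbits\<close>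

definition killing_field :: "'m chart set \<Rightarrow> 'm field2 \<Rightarrow> 'm field1 \<Rightarrow> bool" where
  "killing_field A g v \<longleftrightarrow> vector_field A UNIV v \<and>
     (\<forall>c\<in>A. \<forall>x\<in>cimg c UNIV. lie_cov2 (v c) (g c) x = 0)"

definition commuting_fields :: "'m chart set \<Rightarrow> 'm field1 \<Rightarrow> 'm field1 \<Rightarrow> bool" where
  "commuting_fields A u v \<longleftrightarrow> (\<forall>c\<in>A. \<forall>x\<in>cimg c UNIV. lie_bracket (u c) (v c) x = 0)"

definition integral_curve ::
  "'m::topological_space chart set \<Rightarrow> 'm field1 \<Rightarrow> real set \<Rightarrow> (real \<Rightarrow> 'm) \<Rightarrow> bool" where
  "integral_curve A v I \<gamma> \<longleftrightarrow> continuous_on I \<gamma> \<and>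
     (\<forall>t\<in>I. \<forall>c\<in>A. \<gamma> t \<in> cdom c \<longrightarrow>
        ((\<lambda>s. cmap c (\<gamma> s)) has_vector_derivative v c (cmap c (\<gamma> t))) (at t))"

definition closed_orbits :: "'m::topological_space chart set \<Rightarrow> 'm field1 \<Rightarrow> bool" where
  "closed_orbits A v \<longleftrightarrow> (\<forall>p. \<exists>\<gamma> T. T > 0 \<and> integral_curve A v UNIV \<gamma> \<and> \<gamma> 0 = p \<and>
     (\<forall>t. \<gamma> (t + T) = \<gamma> t))"

definition zero_set :: "'m chart set \<Rightarrow> 'm field1 \<Rightarrow> 'm set" where
  "zero_set A v = {p. \<exists>c\<in>A. p \<in> cdom c \<and> v c (cmap c p) = 0}"

text \<open>The stationary Killing field may be spacelike in places (ergoregions), so it is only required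
  to be timelike somewhere.\<close>
definition stationary_killing :: "'m chart set \<Rightarrow> 'm field2 \<Rightarrow> 'm field1 \<Rightarrow> bool" where
  "stationary_killing A g k \<longleftrightarrow> killing_field A g k \<and>
     (\<exists>c\<in>A. \<exists>x\<in>cimg c UNIV. ip (g c x) (k c x) (k c x) < 0)"

text \<open>The rotation axis \<open>zero_set A m\<close> may be empty, but the field must not vanish identically.\<close>
definition axial_killing ::
  "'m::topological_space chart set \<Rightarrow> 'm field2 \<Rightarrow> 'm field1 \<Rightarrow> bool" where
  "axial_killing A g m \<longleftrightarrow>
     killing_field A g m \<and> closed_orbits A m \<and> zero_set A m \<noteq> UNIV"

section \<open>Killing horizons\<close>

definition defining_function ::
  "'m chart \<Rightarrow> 'm set \<Rightarrow> (real^4) set \<Rightarrow> (real^4 \<Rightarrow> real) \<Rightarrow> bool" where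
  "defining_function c H V f \<longleftrightarrow> open V \<and> V \<subseteq> cimg c UNIV \<and> smooth_on V f \<and>
     (\<forall>x\<in>V. grad f x \<noteq> 0) \<and> V \<inter> cimg c H = {x\<in>V. f x = 0}"

definition hypersurface :: "'m chart set \<Rightarrow> 'm set \<Rightarrow> bool" where
  "hypersurface A H \<longleftrightarrow> (\<forall>p\<in>H. \<exists>c\<in>A. \<exists>V f.
     p \<in> cdom c \<and> cmap c p \<in> V \<and> defining_function c H V f)"

definition tangent_to :: "'m chart set \<Rightarrow> 'm set \<Rightarrow> 'm field1 \<Rightarrow> bool" where
  "tangent_to A H v \<longleftrightarrow> (\<forall>c\<in>A. \<forall>V f. defining_function c H V f \<longrightarrow>
     (\<forall>x\<in>V. f x = 0 \<longrightarrow> (\<Sum>a\<in>UNIV. v c x $ a * pd a f x) = 0))"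

definition null_hypersurface :: "'m chart set \<Rightarrow> 'm field2 \<Rightarrow> 'm set \<Rightarrow> bool" where
  "null_hypersurface A g H \<longleftrightarrow> hypersurface A H \<and>
     (\<forall>c\<in>A. \<forall>V f. defining_function c H V f \<longrightarrow> (\<forall>x\<in>V. f x = 0 \<longrightarrow>
        ip (g c x) (raise (g c x) (grad f x)) (raise (g c x) (grad f x)) = 0))"

definition normal_to :: "'m chart set \<Rightarrow> 'm field2 \<Rightarrow> 'm set \<Rightarrow> 'm field1 \<Rightarrow> bool" where
  "normal_to A g H v \<longleftrightarrow> (\<forall>c\<in>A. \<forall>V f. defining_function c H V f \<longrightarrow> (\<forall>x\<in>V. f x = 0 \<longrightarrow>
     v c x \<noteq> 0 \<and> (\<exists>r. lower (g c x) (v c x) = r *\<^sub>R grad f x)))"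

definition killing_horizon :: "'m chart set \<Rightarrow> 'm field2 \<Rightarrow> 'm field1 \<Rightarrow> 'm set \<Rightarrow> bool" where
  "killing_horizon A g v H \<longleftrightarrow>
     killing_field A g v \<and> null_hypersurface A g H \<and> normal_to A g H v"

text \<open>Tangency alone would let an orbit run off an edge of \<open>H\<close>, as \<open>H\<close> need not be closed.\<close>
definition invariant_under :: "'m::topological_space chart set \<Rightarrow> 'm set \<Rightarrow> 'm field1 \<Rightarrow> bool" where
  "invariant_under A H v \<longleftrightarrow> tangent_to A H v \<and>
     (\<forall>I \<gamma>. open I \<and> connected I \<and> integral_curve A v I \<gamma> \<and> \<gamma> ` I \<inter> H \<noteq> {} \<longrightarrow> \<gamma> ` I \<subseteq> H)"

section \<open>Electromagnetic fields\<close>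

definition maxwell ::
  "'m chart set \<Rightarrow> 'm field2 \<Rightarrow> 'm set \<Rightarrow> 'm field2 \<Rightarrow> 'm field1 \<Rightarrow> 'm field1 \<Rightarrow> bool" where
  "maxwell A g S F Je Jm \<longleftrightarrow> (\<forall>c\<in>A. \<forall>x\<in>cimg c S. \<forall>i j l.
     d2 (F c) x i j l = 4 * pi * hodge1 (g c x) (Jm c x) i j l \<and>
     d2 (\<lambda>y. hodge2 (g c y) (F c y)) x i j l = 4 * pi * hodge1 (g c x) (Je c x) i j l)"

definition electric_potential ::
  "'m chart set \<Rightarrow> 'm field1 \<Rightarrow> 'm field2 \<Rightarrow> 'm set \<Rightarrow> ('m \<Rightarrow> real) \<Rightarrow> bool" where
  "electric_potential A v F U \<Phi> \<longleftrightarrow> smooth_scalar A U \<Phi> \<and>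
     (\<forall>c\<in>A. \<forall>x\<in>cimg c U. grad (\<Phi> \<circ> cinv c) x = - contract2 (v c x) (F c x))"

definition magnetic_potential ::
  "'m chart set \<Rightarrow> 'm field2 \<Rightarrow> 'm field1 \<Rightarrow> 'm field2 \<Rightarrow> 'm set \<Rightarrow> ('m \<Rightarrow> real) \<Rightarrow> bool" where
  "magnetic_potential A g v F U \<Psi> \<longleftrightarrow> smooth_scalar A U \<Psi> \<and>
     (\<forall>c\<in>A. \<forall>x\<in>cimg c U.
        grad (\<Psi> \<circ> cinv c) x = contract2 (v c x) (hodge2 (g c x) (F c x)))"

end

theory Submission
  imports Defs
begin

text \<open>
  Write \<open>q F = F(k,m)\<close>. Since \<open>F\<close> is invariant and the fields commute, \<open>d(q F)\<close> is \<open>dF\<close> contracted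
  with \<open>k\<close> and \<open>m\<close>, hence by Maxwell's equations \<open>*J\<close> contracted with \<open>k\<close> and \<open>m\<close>, which vanishes
  because \<open>J\<close> is proportional to \<open>\<xi> = k + \<Omega> m\<close>. So \<open>q F\<close> is locally constant. It vanishes on a component
  of the neighbourhood that meets the axis; and if the potential exists around a whole component
  of the horizon, then it vanishes there because \<open>q F\<close> is, up to sign, the derivative of the potential along
  the closed orbits of \<open>m\<close>. The same holds for \<open>*F\<close>, whose Lie derivatives vanish by naturality of
  the Hodge dual.

  Where \<open>m \<noteq> 0\<close> on the horizon, \<open>\<xi>\<close> is null, \<open>m\<close> is non-null and orthogonal to \<open>\<xi>\<close>, and
  \<open>F(\<xi>,m) = *F(\<xi>,m) = 0\<close> forces \<open>i\<^sub>\<xi> F\<close> and \<open>i\<^sub>\<xi> *F\<close> to be multiples of the 1-form \<open>\<xi>\<close>, which is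
  normal to the horizon. This extends to the axis by continuity: a Killing field that vanishes on an
  open piece of a hypersurface has vanishing 1-jet there, hence vanishes identically. So the
  potentials have no derivative tangential to the horizon.
\<close>

section \<open>Levi-Civita symbol and Hodge dual in coordinates\<close>

text \<open>The algebra behind "forces" is special to dimension 4. Let \<open>T\<close> be the
  bivector obtained by raising \<open>F\<close>. Then \<open>*F(\<xi>,m) = 0\<close> says that the
  wedge product of \<open>T\<close>, \<open>\<xi>\<close> and \<open>m\<close>, a single number,
  vanishes. When it is contracted with the 1-forms of \<open>m\<close> and \<open>\<xi>\<close>, the
  relations \<open>(\<xi>|\<xi>) = (\<xi>|m) = 0\<close> and \<open>F(\<xi>,m) = 0\<close> remove
  all terms but \<open>(m|m)\<close> times the wedge product of the contraction of \<open>T\<close>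
  with \<open>\<xi>\<close> and \<open>\<xi>\<close> itself. The factor \<open>(m|m)\<close> is lost
  on the axis, hence the detour through continuity and rigidity. The dual is treated by exchanging
  its role with that of \<open>F\<close>.

  Local constancy leaves an undetermined constant. A potential on part of the horizon cannot fix it
  through closed orbits, because these may leave its domain; this is why there are two cases.

  Lie derivatives are never integrated to flows: invariance of the dual comes from differentiating
  its behaviour under linear changes of basis. Nor is the horizon parametrised: a differentiable
  retraction of an open set onto a level set takes the place of a manifold structure on it.\<close>

lemma vector_4 [simp]:
  "(vector [x,y,z,w] :: ('a::zero)^4) $ 1 = x"
  "(vector [x,y,z,w] :: ('a::zero)^4) $ 2 = y"
  "(vector [x,y,z,w] :: ('a::zero)^4) $ 3 = z"
  "(vector [x,y,z,w] :: ('a::zero)^4) $ 4 = w"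
  unfolding vector_def by simp_all

text \<open>Obtained by peeling one index at a time off the permutations in the Leibniz formula. The
  polynomial form lets identities between four-dimensional tensors be settled by ring
  normalisation.\<close>

lemma det_4:
  "det (A::'a::comm_ring_1^4^4) =
    A$1$1 * (A$2$2 * (A$3$3 * A$4$4 - A$3$4 * A$4$3) - A$2$3 * (A$3$2 * A$4$4 - A$3$4 * A$4$2) + A$2$4 * (A$3$2 * A$4$3 - A$3$3 * A$4$2))
  - A$1$2 * (A$2$1 * (A$3$3 * A$4$4 - A$3$4 * A$4$3) - A$2$3 * (A$3$1 * A$4$4 - A$3$4 * A$4$1) + A$2$4 * (A$3$1 * A$4$3 - A$3$3 * A$4$1))
  + A$1$3 * (A$2$1 * (A$3$2 * A$4$4 - A$3$4 * A$4$2) - A$2$2 * (A$3$1 * A$4$4 - A$3$4 * A$4$1) + A$2$4 * (A$3$1 * A$4$2 - A$3$2 * A$4$1))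
  - A$1$4 * (A$2$1 * (A$3$2 * A$4$3 - A$3$3 * A$4$2) - A$2$2 * (A$3$1 * A$4$3 - A$3$3 * A$4$1) + A$2$3 * (A$3$1 * A$4$2 - A$3$2 * A$4$1))"
proof -
  have f: "finite {2::4, 3, 4}" "1 \<notin> {2::4, 3, 4}" "finite {3::4, 4}" "2 \<notin> {3::4, 4}" "finite {4::4}" "3 \<notin> {4::4}"
    by auto
  show ?thesis
    unfolding det_def UNIV_4
    unfolding sum_over_permutations_insert[OF f(1,2)]
    unfolding sum_over_permutations_insert[OF f(3,4)]
    unfolding sum_over_permutations_insert[OF f(5,6)]
    unfolding permutes_sing
    by (simp add: sign_swap_id permutation_swap_id sign_compose permutation_compose sign_id
        algebra_simps transpose_def)
qed

text \<open>The metric-free Levi-Civita symbol as a multilinear function of vectors;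
  \<open>vol\<close> is \<open>sqrt \<bar>det G\<bar>\<close> times its values on basis
  vectors.\<close>

definition eps4 :: "real^4 \<Rightarrow> real^4 \<Rightarrow> real^4 \<Rightarrow> real^4 \<Rightarrow> real" where
  "eps4 u v w z = det (vector [u, v, w, z] :: real^4^4)"

lemma linear_eps4:
  "linear (\<lambda>u. eps4 u v w z)" "linear (\<lambda>v. eps4 u v w z)"
  "linear (\<lambda>w. eps4 u v w z)" "linear (\<lambda>z. eps4 u v w z)"
  by (rule linearI; simp add: eps4_def det_4 algebra_simps)+

lemma eps4_matrix_vector_mult:
  "eps4 (P *v u) (P *v v) (P *v w) (P *v z) = det P * eps4 u v w z"
proof -
  have "vector [P *v u, P *v v, P *v w, P *v z] = (vector [u, v, w, z] :: real^4^4) ** transpose P"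
    by (simp add: vec_eq_iff forall_4 matrix_matrix_mult_def matrix_vector_mult_def transpose_def mult.commute)
  then show ?thesis
    by (simp add: eps4_def det_mul)
qed

lemma vec_eq_sum_axis: "(u :: real^4) = (\<Sum>a\<in>UNIV. u $ a *\<^sub>R axis a 1)"
  by (simp add: vec_eq_iff forall_4 sum_4 axis_def)

lemma linear_sum_axis:
  fixes f :: "real^4 \<Rightarrow> real"
  assumes "linear f"
  shows "(\<Sum>a\<in>UNIV. u $ a * f (axis a 1)) = f u"
proof -
  have "f u = f (\<Sum>a\<in>UNIV. u $ a *\<^sub>R axis a 1)"
    using vec_eq_sum_axis by metis
  then show ?thesis
    using assms by (simp add: linear_sum linear_cmul)
qed

lemmas sum_eps4_axis = linear_eps4[THEN linear_sum_axis]

lemma sum_swap_pairs: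
  "(\<Sum>a\<in>A. \<Sum>b\<in>B. \<Sum>c\<in>C. \<Sum>d\<in>D. f a b c d) = (\<Sum>c\<in>C. \<Sum>d\<in>D. \<Sum>a\<in>A. \<Sum>b\<in>B. f a b c d)"
proof -
  have "(\<Sum>a\<in>A. \<Sum>b\<in>B. \<Sum>c\<in>C. \<Sum>d\<in>D. f a b c d)
      = (\<Sum>p\<in>A \<times> B. \<Sum>q\<in>C \<times> D. f (fst p) (snd p) (fst q) (snd q))"
    by (simp add: sum.cartesian_product')
  also have "\<dots> = (\<Sum>q\<in>C \<times> D. \<Sum>p\<in>A \<times> B. f (fst p) (snd p) (fst q) (snd q))"
    by (rule sum.swap)
  also have "\<dots> = (\<Sum>c\<in>C. \<Sum>d\<in>D. \<Sum>a\<in>A. \<Sum>b\<in>B. f a b c d)"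
    by (simp add: sum.cartesian_product')
  finally show ?thesis .
qed

text \<open>A contravariant bivector contracted with the first two slots of the symbol. Up to the
  volume density, the dual of a 2-form is this contraction of its raised form, which separates the
  metric from the alternating algebra.\<close>

definition eps_bivector :: "real^4^4 \<Rightarrow> real^4 \<Rightarrow> real^4 \<Rightarrow> real" where
  "eps_bivector T w z = (\<Sum>a\<in>UNIV. \<Sum>b\<in>UNIV. T $ a $ b * eps4 (axis a 1) (axis b 1) w z)"

lemma linear_eps_bivector: "linear (\<lambda>w. eps_bivector T w z)" "linear (\<lambda>z. eps_bivector T w z)"
  by (rule linearI; simp add: eps_bivector_def linear_eps4[THEN linear_add] linear_eps4[THEN linear_cmul]
      sum.distrib distrib_left sum_distrib_left mult_ac)+

lemma eps_bivector_matrix: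
  "eps_bivector (P ** T ** transpose P) (P *v w) (P *v z) = det P * eps_bivector T w z"
proof -
  let ?e = "\<lambda>a b. eps4 (axis a 1) (axis b 1) (P *v w) (P *v z)"
  have P: "P $ a $ c * P $ b $ d * ?e a b = (P *v axis c 1) $ a * ((P *v axis d 1) $ b * ?e a b)" for a b c d
    by (simp add: matrix_vector_mul_component inner_axis)
  have "(\<Sum>a\<in>UNIV. \<Sum>b\<in>UNIV. P $ a $ c * P $ b $ d * ?e a b)
      = det P * eps4 (axis c 1) (axis d 1) w z" for c d
    unfolding P sum_distrib_left[symmetric] sum_eps4_axis eps4_matrix_vector_mult ..
  moreover have "eps_bivector (P ** T ** transpose P) (P *v w) (P *v z)
      = (\<Sum>a\<in>UNIV. \<Sum>b\<in>UNIV. \<Sum>d\<in>UNIV. \<Sum>c\<in>UNIV. T $ c $ d * (P $ a $ c * P $ b $ d * ?e a b))"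
    by (simp add: eps_bivector_def matrix_matrix_mult_def transpose_def sum_distrib_left
        sum_distrib_right mult_ac)
  ultimately have "eps_bivector (P ** T ** transpose P) (P *v w) (P *v z)
      = (\<Sum>d\<in>UNIV. \<Sum>c\<in>UNIV. T $ c $ d * (det P * eps4 (axis c 1) (axis d 1) w z))"
    by (simp add: sum_swap_pairs[of _ "UNIV :: 4 set" "UNIV :: 4 set"] sum_distrib_left[symmetric])
  also have "\<dots> = det P * eps_bivector T w z"
    by (subst sum.swap) (simp add: eps_bivector_def sum_distrib_left mult_ac)
  finally show ?thesis .
qed

section \<open>Naturality of the Hodge dual on 2-forms\<close>

lemma matrix_inv_mult:
  assumes "invertible A"
  shows "A ** matrix_inv A = mat 1" "matrix_inv A ** A = mat 1"
proof -
  have "A ** matrix_inv A = mat 1 \<and> matrix_inv A ** A = mat 1"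
    using assms unfolding invertible_def matrix_inv_def by (rule someI_ex)
  then show "A ** matrix_inv A = mat 1" "matrix_inv A ** A = mat 1"
    by auto
qed

lemma matrix_inv_eqI:
  fixes A :: "'a::field^'n^'n"
  assumes "A ** B = mat 1"
  shows "matrix_inv A = B"
proof -
  have "B ** A = mat 1"
    using assms matrix_left_right_inverse by blast
  then have "invertible A"
    using assms invertible_def by blast
  then have "matrix_inv A = (matrix_inv A ** A) ** B"
    using assms by (metis matrix_mul_assoc matrix_mul_rid)
  then show ?thesis
    using matrix_inv_mult(2)[OF \<open>invertible A\<close>] by simp
qed

definition raise2 :: "real^4^4 \<Rightarrow> real^4^4 \<Rightarrow> real^4^4" where
  "raise2 G F = matrix_inv G ** F ** transpose (matrix_inv G)"

lemma hodge2_eps_bivector: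
  "hodge2 G F $ c $ d = sqrt \<bar>det G\<bar> / 2 * eps_bivector (raise2 G F) (axis c 1) (axis d 1)"
  by (simp add: hodge2_def eps_bivector_def raise2_def vol_def eps4_def sum_distrib_left mult_ac)

lemma inner_hodge2:
  "w \<bullet> (hodge2 G F *v z) = sqrt \<bar>det G\<bar> / 2 * eps_bivector (raise2 G F) w z"
proof -
  have "w \<bullet> (hodge2 G F *v z) = (\<Sum>c\<in>UNIV. w $ c * (\<Sum>d\<in>UNIV. z $ d * hodge2 G F $ c $ d))"
    by (simp add: inner_vec_def matrix_vector_mult_def mult.commute)
  also have "\<dots> = sqrt \<bar>det G\<bar> / 2 *
      (\<Sum>c\<in>UNIV. w $ c * (\<Sum>d\<in>UNIV. z $ d * eps_bivector (raise2 G F) (axis c 1) (axis d 1)))"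
    by (simp add: hodge2_eps_bivector sum_distrib_left mult_ac)
  finally show ?thesis
    by (simp add: linear_eps_bivector[THEN linear_sum_axis])
qed

text \<open>Raising both indices turns the congruence by \<open>P\<close> into a push-forward of
  bivectors, which brings a factor \<open>det P\<close> out of the symbol; the volume density
  contributes \<open>\<bar>det P\<bar>\<close>. The two factors agree because \<open>P\<close>
  preserves the orientation.\<close>

lemma hodge2_congruence:
  assumes "invertible G" "det P > 0"
  shows "hodge2 (transpose P ** G ** P) (transpose P ** F ** P) = transpose P ** hodge2 G F ** P"
proof -
  let ?P' = "matrix_inv P" and ?G' = "matrix_inv G"
  have P: "P ** ?P' = mat 1" "?P' ** P = mat 1"
    using assms matrix_inv_mult[of P] by (auto simp: invertible_det_nz)
  have tP: "transpose ?P' ** transpose P = mat 1" "transpose P ** transpose ?P' = mat 1"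
    using P by (metis matrix_transpose_mul transpose_mat)+
  have G: "G ** ?G' = mat 1" "transpose ?G' ** transpose G = mat 1"
    using assms matrix_inv_mult[of G] by (metis matrix_transpose_mul transpose_mat)+
  have PP: "A ** P ** ?P' = A" "A ** ?P' ** P = A" "A ** transpose ?P' ** transpose P = A"
    "A ** transpose P ** transpose ?P' = A" "A ** G ** ?G' = A" for A :: "real^4^4"
    using P tP G by (metis matrix_mul_assoc matrix_mul_rid)+
  have inv: "matrix_inv (transpose P ** G ** P) = ?P' ** ?G' ** transpose ?P'"
    by (rule matrix_inv_eqI) (simp add: matrix_mul_assoc PP tP)
  have "P ** raise2 (transpose P ** G ** P) (transpose P ** F ** P) ** transpose P = raise2 G F"
    by (simp add: raise2_def inv matrix_transpose_mul matrix_mul_assoc PP P)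
  then have "eps_bivector (raise2 G F) (P *v w) (P *v z)
      = det P * eps_bivector (raise2 (transpose P ** G ** P) (transpose P ** F ** P)) w z" for w z
    by (metis eps_bivector_matrix)
  moreover have "sqrt \<bar>det (transpose P ** G ** P)\<bar> = det P * sqrt \<bar>det G\<bar>"
    using assms by (simp add: det_mul abs_mult real_sqrt_mult)
  ultimately have "(P *v w) \<bullet> (hodge2 G F *v (P *v z))
     = w \<bullet> (hodge2 (transpose P ** G ** P) (transpose P ** F ** P) *v z)" for w z
    by (simp add: inner_hodge2)
  moreover have "(P *v w) \<bullet> (hodge2 G F *v (P *v z)) = w \<bullet> ((transpose P ** hodge2 G F ** P) *v z)" for w z
    unfolding matrix_vector_mul_assoc[symmetric] transpose_matrix_vector
    by (metis dot_lmul_matrix inner_commute)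
  ultimately show ?thesis
    by (metis matrix_eq vector_eq_rdot inner_commute)
qed

section \<open>Gradient of an invariant 2-form evaluated on two commuting fields, at a point\<close>

lemma transpose_eq_uminusD: "transpose T = - T \<Longrightarrow> T $ j $ i = - T $ i $ j"
  for T :: "real^4^4"
  by (drule arg_cong[of _ _ "\<lambda>M. M $ i $ j"]) (simp add: transpose_def)

text \<open>The pointwise content of Cartan's formula. \<open>DF\<close>, \<open>Dk\<close> and
  \<open>Dm\<close> stand for arrays of partial derivatives, the first index being the direction of
  differentiation. The last three hypotheses are the vanishing of the two Lie derivatives of
  \<open>F\<close> and of the commutator of \<open>k\<close> and \<open>m\<close>; the left side is
  the gradient of \<open>F(k,m)\<close>, the right side the exterior derivative evaluated on
  \<open>k\<close> and \<open>m\<close>.\<close>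

lemma closed_form_contraction:
  fixes F :: "4 \<Rightarrow> 4 \<Rightarrow> real" and k m :: "4 \<Rightarrow> real"
  assumes F: "\<And>a b. F b a = - F a b"
  assumes "\<And>a b. (\<Sum>e\<in>UNIV. k e * DF e a b + F e b * Dk a e + F a e * Dk b e) = 0"
    and "\<And>a b. (\<Sum>e\<in>UNIV. m e * DF e a b + F e b * Dm a e + F a e * Dm b e) = 0"
    and "\<And>e. (\<Sum>b\<in>UNIV. k b * Dm b e - m b * Dk b e) = 0"
  shows "(\<Sum>a\<in>UNIV. \<Sum>b\<in>UNIV. DF c a b * k a * m b + F a b * Dk c a * m b + F a b * k a * Dm c b)
     = (\<Sum>a\<in>UNIV. \<Sum>b\<in>UNIV. k a * m b * (DF a b c + DF b c a + DF c a b))" (is "?L = ?R")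
proof -
  have F0: "F a a = 0" for a
    using F[of a a] by linarith
  have F': "F 2 1 = - F 1 2" "F 3 1 = - F 1 3" "F 4 1 = - F 1 4"
    "F 3 2 = - F 2 3" "F 4 2 = - F 2 4" "F 4 3 = - F 3 4"
    by (rule F)+
  have Fc: "F c 1 = - F 1 c" "F c 2 = - F 2 c" "F c 3 = - F 3 c" "F c 4 = - F 4 c"
    by (rule F)+
  \<comment> \<open>The index orders in the subtracted Lie derivatives make the derivatives of
    \<open>F\<close> cancel term by term, so antisymmetry is used for \<open>F\<close> itself only.
    What remains of the derivatives of \<open>k\<close> and \<open>m\<close> is the
    commutator.\<close>
  have "?L = ?R
    - (\<Sum>b\<in>UNIV. m b * (\<Sum>e\<in>UNIV. k e * DF e b c + F e c * Dk b e + F b e * Dk c e))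
    - (\<Sum>a\<in>UNIV. k a * (\<Sum>e\<in>UNIV. m e * DF e c a + F e a * Dm c e + F c e * Dm a e))
    - (\<Sum>e\<in>UNIV. F e c * (\<Sum>b\<in>UNIV. k b * Dm b e - m b * Dk b e))"
    by (simp only: sum_4 F0 F' Fc) (simp add: algebra_simps)
  then show ?thesis
    by (simp add: assms(2-4))
qed

text \<open>Two Levi-Civita symbols contracted over a pair of indices give an antisymmetriser, so
  the symbol undoes the dual. Both symbols are metric-free, hence no sign from the Lorentzian
  signature; \<open>w\<close> and \<open>z\<close> act as covectors.\<close>

lemma eps_bivector_hodge2:
  assumes "transpose (raise2 G F) = - raise2 G F"
  shows "eps_bivector (hodge2 G F) w z = 2 * sqrt \<bar>det G\<bar> * (w \<bullet> (raise2 G F *v z))"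
proof -
  define T where "T = raise2 G F"
  have T: "T $ j $ i = - T $ i $ j" for i j
    using assms transpose_eq_uminusD T_def by blast
  have T0: "T $ i $ i = 0" for i
    using T[of i i] by linarith
  have T': "T $ 2 $ 1 = - T $ 1 $ 2" "T $ 3 $ 1 = - T $ 1 $ 3" "T $ 4 $ 1 = - T $ 1 $ 4"
    "T $ 3 $ 2 = - T $ 2 $ 3" "T $ 4 $ 2 = - T $ 2 $ 4" "T $ 4 $ 3 = - T $ 3 $ 4"
    by (rule T)+
  have "eps_bivector T u v = 2 * (T $ 1 $ 2 * (u $ 3 * v $ 4 - u $ 4 * v $ 3) + T $ 3 $ 4 * (u $ 1 * v $ 2 - u $ 2 * v $ 1)
       - T $ 1 $ 3 * (u $ 2 * v $ 4 - u $ 4 * v $ 2) - T $ 2 $ 4 * (u $ 1 * v $ 3 - u $ 3 * v $ 1)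
       + T $ 1 $ 4 * (u $ 2 * v $ 3 - u $ 3 * v $ 2) + T $ 2 $ 3 * (u $ 1 * v $ 4 - u $ 4 * v $ 1))" for u v
    by (simp add: eps_bivector_def sum_4 eps4_def det_4 axis_def T0 T') (simp add: algebra_simps)
  then show ?thesis
    unfolding T_def[symmetric] eps_bivector_def[of "hodge2 G F"] hodge2_eps_bivector
    by (simp add: sum_4 eps4_def det_4 axis_def T0 T' inner_vec_def matrix_vector_mult_def)
      (simp add: algebra_simps)
qed

lemma ip_inner: "ip G u v = u \<bullet> (G *v v)"
  by (simp add: ip_def inner_vec_def matrix_vector_mult_def sum_distrib_left mult_ac)

lemma contract2_mult: "contract2 v F = transpose F *v v"
  by (simp add: contract2_def vec_eq_iff matrix_vector_mult_def transpose_def mult.commute)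

lemma uminus_matrix_mul: "(- A) ** B = - (A ** B)" "A ** (- C) = - (A ** C)"
  for A :: "real^'n^'m"
  by (simp_all add: matrix_matrix_mult_def vec_eq_iff sum_negf)

lemma uminus_matrix_vector_mult: "(- A) *v x = - (A *v x)"
  for A :: "real^'n^'m"
  by (simp add: matrix_vector_mult_def vec_eq_iff sum_negf)

lemma transpose_matrix_inv:
  fixes G :: "real^4^4"
  assumes "invertible G" "transpose G = G"
  shows "transpose (matrix_inv G) = matrix_inv G"
  by (rule matrix_inv_eqI[symmetric])
    (metis assms matrix_inv_mult(2) matrix_transpose_mul transpose_mat)

lemma hodge2_antisym: "transpose (hodge2 G F) = - hodge2 G F"
proof -
  have swap: "eps4 u v w z = - eps4 u v z w" for u v w z
    unfolding eps4_def det_4 vector_4 by (simp add: algebra_simps)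
  have "eps_bivector T w z = - eps_bivector T z w" for T w z
    unfolding eps_bivector_def swap[of _ _ w z] mult_minus_right sum_negf ..
  then have "hodge2 G F $ j $ i = - hodge2 G F $ i $ j" for i j
    unfolding hodge2_eps_bivector by (metis mult_minus_right)
  then show ?thesis
    unfolding vec_eq_iff transpose_def vec_lambda_beta vector_uminus_component by blast
qed

section \<open>Wedge products with bivectors, and contraction with a null vector\<close>

lemma wedge11_zero_iff: "wedge11 u w = 0 \<longleftrightarrow> (\<forall>a b. u $ a * w $ b = u $ b * w $ a)"
  by (auto simp: wedge11_def vec_eq_iff)

lemma wedge11_parallel:
  assumes "wedge11 u w = 0" "w \<noteq> 0"
  obtains r where "u = r *\<^sub>R w"
proof -
  obtain b where b: "w $ b \<noteq> 0"
    using assms(2) by (auto simp: vec_eq_iff)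
  have "u $ a * w $ b = u $ b * w $ a" for a
    using assms(1) wedge11_zero_iff by blast
  then have "u = (u $ b / w $ b) *\<^sub>R w"
    using b by (simp add: vec_eq_iff field_simps)
  then show ?thesis
    by (rule that)
qed

lemma wedge11_scaleR [simp]: "wedge11 (r *\<^sub>R w) w = 0"
  by (simp add: wedge11_zero_iff)

text \<open>The expression is a component of the wedge product of \<open>T\<close>, \<open>u\<close>
  and \<open>v\<close>. In dimension 4 such an array is determined by its component
  \<open>1 2 3 4\<close>, which is half of \<open>eps_bivector T u v\<close>. Having it for all
  indices, repeated ones included, permits summation against vectors.\<close>

lemma wedge_bivector:
  fixes T :: "real^4^4" and u v :: "real^4"
  assumes "transpose T = - T" "eps_bivector T u v = 0"
  shows "T $ a $ b * (u $ c * v $ d - u $ d * v $ c) + T $ c $ d * (u $ a * v $ b - u $ b * v $ a)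
       - T $ a $ c * (u $ b * v $ d - u $ d * v $ b) - T $ b $ d * (u $ a * v $ c - u $ c * v $ a)
       + T $ a $ d * (u $ b * v $ c - u $ c * v $ b) + T $ b $ c * (u $ a * v $ d - u $ d * v $ a) = 0"
proof -
  have T: "T $ j $ i = - T $ i $ j" for i j
    using arg_cong[OF assms(1), of "\<lambda>M. M $ i $ j"] by (simp add: transpose_def)
  have T0: "T $ i $ i = 0" for i
    using T[of i i] by linarith
  have T': "T $ 2 $ 1 = - T $ 1 $ 2" "T $ 3 $ 1 = - T $ 1 $ 3" "T $ 4 $ 1 = - T $ 1 $ 4"
    "T $ 3 $ 2 = - T $ 2 $ 3" "T $ 4 $ 2 = - T $ 2 $ 4" "T $ 4 $ 3 = - T $ 3 $ 4"
    by (rule T)+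
  define W where "W a b c d = T $ a $ b * (u $ c * v $ d - u $ d * v $ c) + T $ c $ d * (u $ a * v $ b - u $ b * v $ a)
       - T $ a $ c * (u $ b * v $ d - u $ d * v $ b) - T $ b $ d * (u $ a * v $ c - u $ c * v $ a)
       + T $ a $ d * (u $ b * v $ c - u $ c * v $ b) + T $ b $ c * (u $ a * v $ d - u $ d * v $ a)" for a b c d
  have "eps_bivector T u v = 2 * W 1 2 3 4"
    by (simp add: eps_bivector_def sum_4 eps4_def det_4 axis_def T0 T' W_def) (simp add: algebra_simps)
  then have q: "W 1 2 3 4 = 0"
    using assms by auto
  have swap: "W b a c d = - W a b c d" "W a c b d = - W a b c d" "W a b d c = - W a b c d" for a b c d
    unfolding W_def by (simp_all only: T[of a b] T[of b c] T[of c d]) (simp_all add: algebra_simps)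
  have "W a a c d = 0" "W a b b d = 0" "W a b c c = 0" for a b c d
    using swap(1)[of a a c d] swap(2)[of a b b d] swap(3)[of a b c c] by linarith+
  \<comment> \<open>Only the instances that move a smaller index to the left are kept, so rewriting
    sorts each index tuple and terminates; tuples with a repetition end in one of the vanishing
    cases.\<close>
  note W = this q swap(1)[where b=2 and a=1] swap(1)[where b=3 and a=1] swap(1)[where b=4 and a=1]
    swap(1)[where b=3 and a=2] swap(1)[where b=4 and a=2] swap(1)[where b=4 and a=3]
    swap(2)[where c=2 and b=1] swap(2)[where c=3 and b=1] swap(2)[where c=4 and b=1]
    swap(2)[where c=3 and b=2] swap(2)[where c=4 and b=2] swap(2)[where c=4 and b=3]
    swap(3)[where d=2 and c=1] swap(3)[where d=3 and c=1] swap(3)[where d=4 and c=1]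
    swap(3)[where d=3 and c=2] swap(3)[where d=4 and c=2] swap(3)[where d=4 and c=3]
  have "\<forall>a b c d. W a b c d = 0"
    unfolding forall_4 by (simp only: W neg_0_equal_iff_equal minus_zero simp_thms)
  then show ?thesis
    by (simp add: W_def)
qed

text \<open>Contract the vanishing wedge product of \<open>T\<close>, \<open>u\<close> and
  \<open>v\<close> with \<open>y\<close> and then with \<open>x\<close>: the hypotheses leave only
  \<open>y \<bullet> v\<close> times the claim. No metric enters, so the lemma serves the raised
  form with vectors \<open>u\<close>, \<open>v\<close> as well as the dual form with covectors in
  their place.\<close>

lemma wedge_bivector_contract:
  fixes T :: "real^4^4" and u v x y :: "real^4"
  assumes T: "transpose T = - T" and q: "eps_bivector T u v = 0"
    and 0: "x \<bullet> u = 0" "x \<bullet> v = 0" "y \<bullet> u = 0" "x \<bullet> (T *v y) = 0" and "y \<bullet> v \<noteq> 0"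
  shows "wedge11 (T *v x) u = 0"
proof -
  have "(T *v x) $ a * u $ b - (T *v x) $ b * u $ a = 0" for a b
  proof -
    have dot: "r *v z = (\<chi> i. r $ i $ 1 * z $ 1 + r $ i $ 2 * z $ 2 + r $ i $ 3 * z $ 3 + r $ i $ 4 * z $ 4)"
        "z \<bullet> w = z $ 1 * w $ 1 + z $ 2 * w $ 2 + z $ 3 * w $ 3 + z $ 4 * w $ 4" for r :: "real^4^4" and z w :: "real^4"
      by (simp_all add: inner_vec_def matrix_vector_mult_def sum_4)
    \<comment> \<open>Contraction over \<open>d\<close> with \<open>y\<close>. The contraction over
      \<open>c\<close> with \<open>x\<close> follows once the terms with
      \<open>y \<bullet> u\<close> have been dropped.\<close>
    have "T $ a $ b * (u $ c * (y \<bullet> v) - v $ c * (y \<bullet> u)) + (T *v y) $ c * (u $ a * v $ b - u $ b * v $ a)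
       - T $ a $ c * (u $ b * (y \<bullet> v) - v $ b * (y \<bullet> u)) - (T *v y) $ b * (u $ a * v $ c - u $ c * v $ a)
       + (T *v y) $ a * (u $ b * v $ c - u $ c * v $ b) + T $ b $ c * (u $ a * (y \<bullet> v) - v $ a * (y \<bullet> u)) = 0" (is "?L = 0") for c
    proof -
      have W: "(T $ a $ b * (u $ c * v $ d - u $ d * v $ c) + T $ c $ d * (u $ a * v $ b - u $ b * v $ a)
       - T $ a $ c * (u $ b * v $ d - u $ d * v $ b) - T $ b $ d * (u $ a * v $ c - u $ c * v $ a)
       + T $ a $ d * (u $ b * v $ c - u $ c * v $ b) + T $ b $ c * (u $ a * v $ d - u $ d * v $ a)) * y $ d = 0" for d
        by (simp only: wedge_bivector[OF T q] mult_zero_left)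
      have "0 = (\<Sum>d\<in>UNIV. (T $ a $ b * (u $ c * v $ d - u $ d * v $ c) + T $ c $ d * (u $ a * v $ b - u $ b * v $ a)
       - T $ a $ c * (u $ b * v $ d - u $ d * v $ b) - T $ b $ d * (u $ a * v $ c - u $ c * v $ a)
       + T $ a $ d * (u $ b * v $ c - u $ c * v $ b) + T $ b $ c * (u $ a * v $ d - u $ d * v $ a)) * y $ d)"
        by (simp only: W sum.neutral_const)
      also have "\<dots> = ?L"
        by (simp only: dot sum_4 vec_lambda_beta) (simp add: algebra_simps)
      finally show ?thesis ..
    qed
    then have W: "(T $ a $ b * u $ c * (y \<bullet> v) + (T *v y) $ c * (u $ a * v $ b - u $ b * v $ a)
       - T $ a $ c * u $ b * (y \<bullet> v) - (T *v y) $ b * (u $ a * v $ c - u $ c * v $ a)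
       + (T *v y) $ a * (u $ b * v $ c - u $ c * v $ b) + T $ b $ c * u $ a * (y \<bullet> v)) * x $ c = 0" for c
      using 0 by (simp add: mult.assoc)
    have "T $ a $ b * (x \<bullet> u) * (y \<bullet> v) + (x \<bullet> (T *v y)) * (u $ a * v $ b - u $ b * v $ a)
       - (T *v x) $ a * u $ b * (y \<bullet> v) - (T *v y) $ b * (u $ a * (x \<bullet> v) - (x \<bullet> u) * v $ a)
       + (T *v y) $ a * (u $ b * (x \<bullet> v) - (x \<bullet> u) * v $ b) + (T *v x) $ b * u $ a * (y \<bullet> v) = 0"
      (is "?L = 0")
    proof -
      have "0 = (\<Sum>c\<in>UNIV. (T $ a $ b * u $ c * (y \<bullet> v) + (T *v y) $ c * (u $ a * v $ b - u $ b * v $ a)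
       - T $ a $ c * u $ b * (y \<bullet> v) - (T *v y) $ b * (u $ a * v $ c - u $ c * v $ a)
       + (T *v y) $ a * (u $ b * v $ c - u $ c * v $ b) + T $ b $ c * u $ a * (y \<bullet> v)) * x $ c)"
        by (simp only: W sum.neutral_const)
      also have "\<dots> = ?L"
        by (simp only: dot(2)[of x] dot(1)[of T x] sum_4 vec_lambda_beta) (simp add: algebra_simps)
      finally show ?thesis ..
    qed
    then have "((T *v x) $ a * u $ b - (T *v x) $ b * u $ a) * (y \<bullet> v) = 0"
      unfolding 0 by algebra
    then show ?thesis using assms(7) by (metis mult_eq_0_iff)
  qed
  then show ?thesis
    by (simp add: wedge11_def vec_eq_iff)
qed

text \<open>For \<open>F\<close>, the hypothesis on the dual is the vanishing wedge product for the
  raised form \<open>T\<close>, and \<open>F(u,v) = 0\<close> is the remaining condition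
  \<open>x \<bullet> (T *v y) = 0\<close> of the contraction lemma. For the dual the two hypotheses
  exchange their roles, because applying the symbol to the dual returns \<open>T\<close>.\<close>

lemma null_contractions_parallel:
  fixes G F :: "real^4^4"
  assumes G: "invertible G" "transpose G = G" and F: "transpose F = - F"
    and uv: "ip G u u = 0" "ip G u v = 0" "ip G v v \<noteq> 0"
    and Fuv: "u \<bullet> (F *v v) = 0" "u \<bullet> (hodge2 G F *v v) = 0"
  shows "wedge11 (contract2 u F) (lower G u) = 0"
    and "wedge11 (contract2 u (hodge2 G F)) (lower G u) = 0"
proof -
  define T where "T = raise2 G F"
  have inv: "matrix_inv G ** G = mat 1" "G ** matrix_inv G = mat 1"
    using G matrix_inv_mult by auto
  have T: "T = matrix_inv G ** F ** matrix_inv G"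
    using G by (simp add: T_def raise2_def transpose_matrix_inv)
  have antisym: "transpose T = - T"
    by (simp add: T matrix_transpose_mul F G transpose_matrix_inv uminus_matrix_mul matrix_mul_assoc)
  have FT: "F = G ** T ** G"
  proof -
    have "G ** T ** G = (G ** matrix_inv G) ** F ** (matrix_inv G ** G)"
      by (simp only: T matrix_mul_assoc)
    then show ?thesis by (simp add: inv)
  qed
  have Gdot: "(G *v a) \<bullet> b = a \<bullet> (G *v b)" for a b
    by (metis G(2) dot_lmul_matrix transpose_matrix_vector)
  have dot: "(G *v u) \<bullet> u = 0" "(G *v u) \<bullet> v = 0" "(G *v v) \<bullet> u = 0" "(G *v v) \<bullet> v \<noteq> 0"
    "u \<bullet> (G *v u) = 0" "u \<bullet> (G *v v) = 0" "v \<bullet> (G *v u) = 0" "v \<bullet> (G *v v) \<noteq> 0"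
    using uv Gdot by (auto simp: ip_inner inner_commute)
  have Tuv: "(G *v u) \<bullet> (T *v (G *v v)) = 0"
    using Fuv(1) by (simp add: FT Gdot matrix_vector_mul_assoc matrix_mul_assoc)
  have "invertible G \<Longrightarrow> det G \<noteq> 0"
    by (simp add: invertible_det_nz)
  then have "eps_bivector T u v = 0"
    using Fuv(2) G by (simp add: inner_hodge2 T_def)
  from wedge_bivector_contract[OF antisym this dot(1-3) Tuv dot(4)]
  have "wedge11 (T *v (G *v u)) u = 0" .
  \<comment> \<open>Transporting the relation by \<open>G\<close> needs an explicit factor, which
    may fail to exist when \<open>u = 0\<close>; there the claim is trivial.\<close>
  then obtain r where "u = 0 \<or> T *v (G *v u) = r *\<^sub>R u"
    using wedge11_parallel by blast
  then have "u = 0 \<or> F *v u = r *\<^sub>R (G *v u)"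
    by (metis FT matrix_vector_mul_assoc matrix_vector_mult_scaleR)
  moreover have "contract2 u F = - (F *v u)"
    by (simp only: contract2_mult F uminus_matrix_vector_mult)
  ultimately have "u = 0 \<or> contract2 u F = (- r) *\<^sub>R (G *v u)"
    by auto
  then show "wedge11 (contract2 u F) (lower G u) = 0"
    using wedge11_scaleR[of "- r"] by (auto simp: lower_def contract2_mult wedge11_zero_iff)
  have "eps_bivector (hodge2 G F) (G *v u) (G *v v) = 0"
    using eps_bivector_hodge2[of G F] antisym Tuv by (simp add: T_def)
  from wedge_bivector_contract[OF hodge2_antisym this dot(5-7) Fuv(2) dot(8)]
  have "wedge11 (hodge2 G F *v u) (G *v u) = 0" .
  moreover have "contract2 u (hodge2 G F) = - (hodge2 G F *v u)"
    by (simp only: contract2_mult hodge2_antisym uminus_matrix_vector_mult)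
  ultimately show "wedge11 (contract2 u (hodge2 G F)) (lower G u) = 0"
    by (simp add: wedge11_zero_iff lower_def)
qed

section \<open>The dual of a current evaluated on two vectors\<close>

lemma eps4_dependent:
  "eps4 (r *\<^sub>R (u + s *\<^sub>R v)) u v w = 0" "eps4 z (s *\<^sub>R v) v w = 0"
  unfolding eps4_def det_4 vector_4 by (simp_all add: algebra_simps)

text \<open>Up to the density, the sum is the symbol evaluated on the raised \<open>w\<close>, on
  \<open>u\<close>, \<open>v\<close> and on a basis vector, and the hypothesis makes the first three
  linearly dependent.\<close>

lemma contract_hodge1_zero:
  assumes G: "invertible G" and "wedge11 w (lower G (u + s *\<^sub>R v)) = 0"
  shows "(\<Sum>a\<in>UNIV. \<Sum>b\<in>UNIV. u $ a * v $ b * hodge1 G w a b c) = 0"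
proof -
  have "(\<Sum>a\<in>UNIV. \<Sum>b\<in>UNIV. u $ a * v $ b * hodge1 G w a b c)
      = (\<Sum>a\<in>UNIV. u $ a * (\<Sum>b\<in>UNIV. v $ b * (sqrt \<bar>det G\<bar> * eps4 (raise G w) (axis a 1) (axis b 1) (axis c 1))))"
    by (simp add: hodge1_def vol_def eps4_def[symmetric] sum_eps4_axis[symmetric, of "raise G w"]
        sum_distrib_left mult_ac)
  also have "\<dots> = sqrt \<bar>det G\<bar> * (\<Sum>a\<in>UNIV. u $ a * (\<Sum>b\<in>UNIV. v $ b * eps4 (raise G w) (axis a 1) (axis b 1) (axis c 1)))"
    by (simp add: sum_distrib_left mult_ac)
  also have "\<dots> = sqrt \<bar>det G\<bar> * eps4 (raise G w) u v (axis c 1)"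
    by (simp only: sum_eps4_axis)
  also have "eps4 (raise G w) u v (axis c 1) = 0"
  \<comment> \<open>If the combination vanishes, the wedge condition says nothing about
    \<open>w\<close>, but then \<open>u\<close> and \<open>v\<close> are dependent by
    themselves.\<close>
  proof (cases "u + s *\<^sub>R v = 0")
    case True
    then have "u = (- s) *\<^sub>R v"
      by (simp add: add_eq_0_iff)
    then show ?thesis
      using eps4_dependent(2) by metis
  next
    case False
    have inv: "matrix_inv G ** G = mat 1"
      using G matrix_inv_mult by auto
    have "lower G (u + s *\<^sub>R v) \<noteq> 0"
      unfolding lower_def by (metis False inv matrix_vector_mul_assoc matrix_vector_mul_lid matrix_vector_mult_0_right)
    then obtain r where "w = r *\<^sub>R lower G (u + s *\<^sub>R v)"
      using assms(2) wedge11_parallel by blast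
    then have "raise G w = r *\<^sub>R (u + s *\<^sub>R v)"
      unfolding raise_def lower_def by (simp add: matrix_vector_mult_scaleR matrix_vector_mul_assoc inv)
    then show ?thesis
      by (simp only: eps4_dependent)
  qed
  finally show ?thesis by simp
qed

section \<open>Derivatives and invariance of the Hodge dual\<close>

lemma differentiable_vec_iff:
  fixes f :: "'a::real_normed_vector \<Rightarrow> 'b::euclidean_space^'n"
  shows "f differentiable at x \<longleftrightarrow> (\<forall>i. (\<lambda>y. f y $ i) differentiable at x)"
proof
  assume "f differentiable at x"
  then have "((\<lambda>y. f y $ i) has_derivative (\<lambda>h. frechet_derivative f (at x) h $ i)) (at x)" for i
    unfolding frechet_derivative_works by (rule bounded_linear.has_derivative[OF bounded_linear_vec_nth])
  then show "\<forall>i. (\<lambda>y. f y $ i) differentiable at x"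
    by (blast intro: differentiableI)
next
  assume "\<forall>i. (\<lambda>y. f y $ i) differentiable at x"
  then obtain f' where f': "\<And>i. ((\<lambda>y. f y $ i) has_derivative f' i) (at x)"
    unfolding differentiable_def by metis
  have "(f has_derivative (\<lambda>h. \<chi> i. f' i h)) (at x)"
    unfolding has_derivative_componentwise_within[of f]
  proof
    fix e :: "'b^'n" assume "e \<in> Basis"
    then obtain i u where e: "e = axis i u"
      by (auto simp: Basis_vec_def)
    have "((\<lambda>y. f y $ i \<bullet> u) has_derivative (\<lambda>h. f' i h \<bullet> u)) (at x)"
      by (rule has_derivative_inner_left[OF f'])
    then show "((\<lambda>y. f y \<bullet> e) has_derivative (\<lambda>h. (\<chi> i. f' i h) \<bullet> e)) (at x)"
      by (simp add: e inner_axis)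
  qed
  then show "f differentiable at x"
    by (rule differentiableI)
qed

lemma has_derivative_pd: "(f has_derivative f') (at x) \<Longrightarrow> pd i f x = f' (axis i 1)"
  unfolding pd_def by (metis frechet_derivative_at)

lemma pd_has_derivative:
  assumes "f differentiable at x"
  shows "(f has_derivative (\<lambda>h. \<Sum>i\<in>UNIV. h $ i * pd i f x)) (at x)"
proof -
  have "linear (frechet_derivative f (at x))"
    using assms by (rule linear_frechet_derivative)
  then have "frechet_derivative f (at x) = (\<lambda>h. \<Sum>i\<in>UNIV. h $ i * pd i f x)"
    by (simp add: fun_eq_iff pd_def linear_sum_axis)
  then show ?thesis
    using assms frechet_derivative_works by metis
qed

lemma pd_mult:
  "f differentiable at x \<Longrightarrow> g differentiable at x \<Longrightarrow>
    pd i (\<lambda>y. f y * g y) x = pd i f x * g x + f x * pd i g x"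
  by (subst has_derivative_pd[OF has_derivative_mult[OF pd_has_derivative pd_has_derivative]])
    (auto simp: axis_def if_distrib if_distribR cong: if_cong)

lemma pd_sum:
  assumes "\<And>j. j \<in> S \<Longrightarrow> f j differentiable at x"
  shows "pd i (\<lambda>y. \<Sum>j\<in>S. f j y) x = (\<Sum>j\<in>S. pd i (f j) x)"
  by (subst has_derivative_pd[OF has_derivative_sum[OF pd_has_derivative[OF assms]]])
    (auto simp: axis_def if_distrib if_distribR cong: if_cong)

lemma has_derivative_nth2:
  "(T has_derivative T') (at x) \<Longrightarrow> ((\<lambda>y. T y $ a $ b) has_derivative (\<lambda>h. T' h $ a $ b)) (at x)"
  for T :: "'a::real_normed_vector \<Rightarrow> real^'n^'m"
  by (intro bounded_linear.has_derivative[OF bounded_linear_vec_nth])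

lemma directional_derivative:
  fixes f :: "real^4 \<Rightarrow> real"
  assumes "(f has_derivative f') (at x)"
  shows "(\<Sum>c\<in>UNIV. v $ c * pd c f x) = f' v"
  using assms by (simp add: has_derivative_pd linear_sum_axis has_derivative_linear)

text \<open>The terms of the Lie derivative that do not differentiate \<open>T\<close> form the
  infinitesimal congruence of \<open>T\<close> by the matrix of partial derivatives of
  \<open>v\<close>. In this shape it can be compared with naturality under congruences.\<close>

lemma lie_cov2_zero_iff:
  assumes "(T has_derivative T') (at x)"
  shows "lie_cov2 v T x = 0 \<longleftrightarrow>
    T' (v x) = - (transpose (\<chi> c a. pd a (\<lambda>y. v y $ c) x) ** T x + T x ** (\<chi> c a. pd a (\<lambda>y. v y $ c) x))"
proof -
  have "lie_cov2 v T x $ a $ b = T' (v x) $ a $ b +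
      (transpose (\<chi> c a. pd a (\<lambda>y. v y $ c) x) ** T x + T x ** (\<chi> c a. pd a (\<lambda>y. v y $ c) x)) $ a $ b" for a b
    using directional_derivative[OF has_derivative_nth2[OF assms]]
    by (simp add: lie_cov2_def sum.distrib transpose_def matrix_matrix_mult_def mult.commute)
  then have "lie_cov2 v T x = T' (v x) +
      (transpose (\<chi> c a. pd a (\<lambda>y. v y $ c) x) ** T x + T x ** (\<chi> c a. pd a (\<lambda>y. v y $ c) x))"
    unfolding vec_eq_iff vector_add_component by blast
  then show ?thesis
    by (simp only: eq_neg_iff_add_eq_0)
qed

section \<open>Differentiability of the matrix inverse and of the Hodge dual\<close>

lemma differentiable_nth:
  "f differentiable at x \<Longrightarrow> (\<lambda>y. f y $ i) differentiable at x"
  for f :: "'a::real_normed_vector \<Rightarrow> 'b::euclidean_space^'n"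
  using differentiable_vec_iff by blast

lemma differentiable_det:
  fixes A :: "'a::real_normed_vector \<Rightarrow> real^4^4"
  assumes "A differentiable at x"
  shows "(\<lambda>y. det (A y)) differentiable at x"
proof -
  have [simp]: "(\<lambda>y. A y $ i $ j) differentiable at x" for i j
    using assms by (intro differentiable_nth)
  show ?thesis
    by (simp only: det_4) simp
qed

text \<open>Cramer's rule for each column. It exhibits the inverse as a quotient of polynomials in
  the entries, from which differentiability is read off.\<close>

lemma matrix_inv_det:
  fixes G :: "real^4^4"
  assumes "det G \<noteq> 0"
  shows "matrix_inv G = (\<chi> k l. det (\<chi> i j. if j = k then (if i = l then 1 else 0) else G $ i $ j) / det G)"
proof -
  have "G *v (matrix_inv G *v axis l 1) = axis l 1" for l
    using assms matrix_inv_mult(1)[of G] by (simp add: matrix_vector_mul_assoc invertible_det_nz)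
  then have "matrix_inv G *v axis l 1 =
      (\<chi> k. det (\<chi> i j. if j = k then axis l 1 $ i else G $ i $ j) / det G)" for l
    using cramer[OF assms] by blast
  moreover have "axis l (1::real) $ i = (if i = l then 1 else 0)" for i l :: 4
    by (simp add: axis_def)
  ultimately have "(matrix_inv G *v axis l 1) $ k =
      det (\<chi> i j. if j = k then (if i = l then 1 else 0) else G $ i $ j) / det G" for k l
    by (simp only: vec_lambda_beta)
  then show ?thesis
    by (simp add: vec_eq_iff matrix_vector_mul_component inner_axis)
qed

lemma differentiable_matrix_inv:
  fixes A :: "'a::real_normed_vector \<Rightarrow> real^4^4"
  assumes A: "A differentiable at x" and "det (A x) \<noteq> 0"
  shows "(\<lambda>y. matrix_inv (A y)) differentiable at x"
proof -
  let ?adj = "\<lambda>y. \<chi> k l. det (\<chi> i j. if j = k then (if i = l then 1 else 0) else A y $ i $ j) / det (A y)"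
  have "(\<lambda>y. if j = k then c i else A y $ i $ j) differentiable at x" for k c i j
    using differentiable_nth[OF differentiable_nth[OF A]] by (cases "j = k") simp_all
  then have "(\<lambda>y. (\<chi> i j. if j = k then c i else A y $ i $ j) :: real^4^4) differentiable at x" for k c
    by (simp add: differentiable_vec_iff)
  note minor = differentiable_det[OF this]
  have "(\<lambda>y. det (\<chi> i j. if j = k then (if i = l then 1 else 0) else A y $ i $ j) / det (A y)) differentiable at x"
    for k l
    by (intro differentiable_divide minor differentiable_det A assms(2))
  then have adj: "?adj differentiable at x"
    by (simp add: differentiable_vec_iff)
  have "isCont (\<lambda>y. det (A y)) x"
    using differentiable_det[OF A] differentiable_imp_continuous_within by blast
  then obtain S where S: "open S" "x \<in> S" "\<And>y. y \<in> S \<Longrightarrow> det (A y) \<in> - {0}"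
    using assms(2) unfolding continuous_at_open by (metis ComplI open_delete open_UNIV Compl_eq_Diff_UNIV singletonD)
  have "(?adj has_derivative frechet_derivative ?adj (at x)) (at x)"
    using adj frechet_derivative_works by blast
  then have "((\<lambda>y. matrix_inv (A y)) has_derivative frechet_derivative ?adj (at x)) (at x)"
    by (rule has_derivative_transform_within_open[OF _ S(1,2)]) (use S(3) in \<open>simp add: matrix_inv_det\<close>)
  then show ?thesis
    by (rule differentiableI)
qed

lemma differentiable_hodge2:
  fixes G F :: "'a::real_normed_vector \<Rightarrow> real^4^4"
  assumes G: "G differentiable at x" "det (G x) \<noteq> 0" and F: "F differentiable at x"
  shows "(\<lambda>y. hodge2 (G y) (F y)) differentiable at x"
proof -
  have [simp]: "(\<lambda>y. matrix_inv (G y) $ i $ j) differentiable at x" "(\<lambda>y. F y $ i $ j) differentiable at x" for i j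
    using differentiable_matrix_inv[OF G] F by (intro differentiable_nth; simp)+
  obtain D where D: "((\<lambda>y. det (G y)) has_derivative D) (at x)"
    using differentiable_det[OF G(1)] by (auto simp: differentiable_def)
  \<comment> \<open>The absolute value is differentiable at the nonzero number
    \<open>det (G x)\<close>, whatever its sign; for a Lorentzian metric it is negative.\<close>
  obtain N where "((norm :: real \<Rightarrow> real) has_derivative N) (at (det (G x)))"
    using differentiable_norm_at[OF G(2)] by (auto simp: differentiable_def)
  from has_derivative_compose[OF D this] have "((\<lambda>y. \<bar>det (G y)\<bar>) has_derivative (\<lambda>h. N (D h))) (at x)"
    by simp
  from has_derivative_real_sqrt[OF _ this] have [simp]: "(\<lambda>y. sqrt \<bar>det (G y)\<bar>) differentiable at x"
    using G(2) by (auto intro: differentiableI)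
  show ?thesis
    by (simp add: differentiable_vec_iff hodge2_def vol_def matrix_matrix_mult_def transpose_def)
qed

section \<open>Invariance of the Hodge dual\<close>

lemma matrix_add_rdistrib: "(A + B) ** C = A ** C + B ** C"
  for A :: "'a::semiring_1^'n^'m"
  by (simp add: matrix_matrix_mult_def vec_eq_iff sum.distrib distrib_right)

lemma matrix_mult_scaleR: "(r *\<^sub>R A) ** C = r *\<^sub>R (A ** C)" "A ** (r *\<^sub>R D) = r *\<^sub>R (A ** D)"
  for A :: "real^'n^'m"
  by (simp_all add: matrix_matrix_mult_def vec_eq_iff sum_distrib_left mult_ac)

text \<open>Naturality, made infinitesimal. View the dual as a function of the pair of metric and
  form. Differentiating \<open>hodge2_congruence\<close> along
  \<open>P s = mat 1 + s *\<^sub>R B\<close> at \<open>s = 0\<close> shows that its derivative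
  carries the congruence terms of the pair to that of the dual; the chain rule in direction
  \<open>v x\<close> does the rest.\<close>

lemma lie_cov2_hodge2:
  assumes g: "g differentiable at x" "det (g x) \<noteq> 0" and F: "F differentiable at x"
    and Lg: "lie_cov2 v g x = 0" and LF: "lie_cov2 v F x = 0"
  shows "lie_cov2 v (\<lambda>y. hodge2 (g y) (F y)) x = 0"
proof -
  define B where "B = (\<chi> c a. pd a (\<lambda>y. v y $ c) x)"
  define X where "X M = transpose B ** M + M ** B" for M :: "real^4^4"
  let ?h = "\<lambda>p. hodge2 (fst p) (snd p)"
  have "(\<lambda>p. fst p) differentiable at (g x, F x)" "(\<lambda>p. snd p) differentiable at (g x, F x)"
    by (auto intro!: bounded_linear_imp_differentiable bounded_linear_fst bounded_linear_snd)
  then obtain h' where h': "(?h has_derivative h') (at (g x, F x))"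
    using differentiable_hodge2[of fst "(g x, F x)" snd] g(2) by (auto simp: differentiable_def)
  obtain g' F' where gF': "(g has_derivative g') (at x)" "(F has_derivative F') (at x)"
    using g F by (auto simp: differentiable_def)
  have Lie: "g' (v x) = - X (g x)" "F' (v x) = - X (F x)"
    using Lg LF by (simp_all add: lie_cov2_zero_iff[OF gF'(1)] lie_cov2_zero_iff[OF gF'(2)] X_def B_def)
  define P where "P s = mat 1 + s *\<^sub>R B" for s :: real
  define q where "q M s = transpose (P s) ** M ** P s" for M s
  have q: "q M s = M + s *\<^sub>R X M + s\<^sup>2 *\<^sub>R (transpose B ** M ** B)" for M s
  proof -
    have "transpose (P s) = mat 1 + s *\<^sub>R transpose B"
      by (simp add: P_def transpose_def vec_eq_iff mat_def)
    then show ?thesis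
      by (simp add: q_def P_def X_def matrix_add_ldistrib matrix_add_rdistrib matrix_mult_scaleR
          power2_eq_square scaleR_add_right)
  qed
  have q': "(q M has_derivative (\<lambda>s. s *\<^sub>R X M)) (at 0)" for M
  proof -
    have "((\<lambda>s. M + s *\<^sub>R X M + s\<^sup>2 *\<^sub>R (transpose B ** M ** B)) has_derivative
        (\<lambda>s. s *\<^sub>R X M)) (at 0)"
      by (auto intro!: derivative_eq_intros)
    then show ?thesis
      by (simp add: q[abs_def])
  qed
  have "((\<lambda>s. (q (g x) s, q (F x) s)) has_derivative (\<lambda>s. (s *\<^sub>R X (g x), s *\<^sub>R X (F x)))) (at 0)"
    by (intro has_derivative_Pair q')
  moreover have "(?h has_derivative h') (at (q (g x) 0, q (F x) 0))"
    using h' by (simp add: q)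
  ultimately have lhs: "((\<lambda>s. hodge2 (q (g x) s) (q (F x) s)) has_derivative
      (\<lambda>s. h' (s *\<^sub>R X (g x), s *\<^sub>R X (F x)))) (at 0)"
    using has_derivative_compose[of "\<lambda>s. (q (g x) s, q (F x) s)" _ 0 UNIV ?h h'] by simp
  \<comment> \<open>Naturality requires a positive determinant, which \<open>P s\<close> has near
    \<open>s = 0\<close> because \<open>P 0\<close> is the identity.\<close>
  have "isCont (\<lambda>s. det (P s)) 0"
    unfolding P_def det_4 by (intro continuous_intros | simp)+
  moreover have "det (P 0) \<in> {0<..}"
    by (simp add: P_def)
  ultimately obtain S where S: "open S" "0 \<in> S" "\<And>s. s \<in> S \<Longrightarrow> det (P s) \<in> {0<..}"
    unfolding continuous_at_open using open_greaterThan by metis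
  have "(q (hodge2 (g x) (F x)) has_derivative (\<lambda>s. h' (s *\<^sub>R X (g x), s *\<^sub>R X (F x)))) (at 0)"
    using g(2) S(3) by (intro has_derivative_transform_within_open[OF lhs S(1,2)])
      (simp add: q_def hodge2_congruence invertible_det_nz)
  \<comment> \<open>The curve \<open>q (hodge2 (g x) (F x))\<close> has now been differentiated in
    two ways: by the chain rule through the pair and directly.\<close>
  from fun_cong[OF has_derivative_unique[OF this q'], of 1]
  have "h' (- X (g x), - X (F x)) = - X (hodge2 (g x) (F x))"
    using linear_neg[OF has_derivative_linear[OF h'], of "(X (g x), X (F x))"] by simp
  moreover have "((\<lambda>y. ?h (g y, F y)) has_derivative (\<lambda>u. h' (g' u, F' u))) (at x)"
    by (rule has_derivative_compose[OF has_derivative_Pair[OF gF'] h'])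
  then have "((\<lambda>y. hodge2 (g y) (F y)) has_derivative (\<lambda>u. h' (g' u, F' u))) (at x)"
    by simp
  ultimately show ?thesis
    by (simp add: lie_cov2_zero_iff[where x=x] Lie X_def B_def)
qed

section \<open>The contraction of a closed invariant form; smooth functions\<close>

lemma differentiable_inner_matrix:
  fixes F :: "real^4 \<Rightarrow> real^4^4" and k m :: "real^4 \<Rightarrow> real^4"
  assumes "F differentiable at x" "k differentiable at x" "m differentiable at x"
  shows "(\<lambda>y. k y \<bullet> (F y *v m y)) differentiable at x"
proof -
  have [simp]: "(\<lambda>y. F y $ a $ b) differentiable at x" "(\<lambda>y. k y $ a) differentiable at x"
    "(\<lambda>y. m y $ a) differentiable at x" for a b
    using assms by (intro differentiable_nth; simp)+
  show ?thesis
    by (simp add: inner_vec_def matrix_vector_mult_def)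
qed

lemma grad_contraction_zero:
  fixes F :: "real^4 \<Rightarrow> real^4^4" and k m :: "real^4 \<Rightarrow> real^4"
  assumes diff: "F differentiable at x" "k differentiable at x" "m differentiable at x"
    and antisym: "transpose (F x) = - F x"
    and Lie: "lie_cov2 k F x = 0" "lie_cov2 m F x = 0" "lie_bracket k m x = 0"
    and dF: "\<And>c. (\<Sum>a\<in>UNIV. \<Sum>b\<in>UNIV. k x $ a * m x $ b * d2 F x a b c) = 0"
  shows "grad (\<lambda>y. k y \<bullet> (F y *v m y)) x = 0"
proof -
  have D [simp]: "(\<lambda>y. F y $ a $ b) differentiable at x" "(\<lambda>y. k y $ a) differentiable at x"
    "(\<lambda>y. m y $ a) differentiable at x" for a b
    using diff by (intro differentiable_nth; simp)+
  have "pd c (\<lambda>y. k y \<bullet> (F y *v m y)) x = 0" for c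
  proof -
    have "(\<lambda>y. k y \<bullet> (F y *v m y)) = (\<lambda>y. \<Sum>a\<in>UNIV. \<Sum>b\<in>UNIV. F y $ a $ b * k y $ a * m y $ b)"
      by (simp add: inner_vec_def matrix_vector_mult_def sum_distrib_left mult_ac)
    then have "pd c (\<lambda>y. k y \<bullet> (F y *v m y)) x =
      (\<Sum>a\<in>UNIV. \<Sum>b\<in>UNIV. pd c (\<lambda>y. F y $ a $ b) x * k x $ a * m x $ b
        + F x $ a $ b * pd c (\<lambda>y. k y $ a) x * m x $ b + F x $ a $ b * k x $ a * pd c (\<lambda>y. m y $ b) x)"
      by (simp add: pd_sum pd_mult distrib_right)
    also have "\<dots> = (\<Sum>a\<in>UNIV. \<Sum>b\<in>UNIV. k x $ a * m x $ b * (pd a (\<lambda>y. F y $ b $ c) x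
        + pd b (\<lambda>y. F y $ c $ a) x + pd c (\<lambda>y. F y $ a $ b) x))"
    proof (rule closed_form_contraction)
      show "F x $ b $ a = - F x $ a $ b" for a b
        using antisym by (rule transpose_eq_uminusD)
      show "(\<Sum>e\<in>UNIV. k x $ e * pd e (\<lambda>y. F y $ a $ b) x + F x $ e $ b * pd a (\<lambda>y. k y $ e) x
          + F x $ a $ e * pd b (\<lambda>y. k y $ e) x) = 0" for a b
        using Lie(1) by (simp add: lie_cov2_def vec_eq_iff)
      show "(\<Sum>e\<in>UNIV. m x $ e * pd e (\<lambda>y. F y $ a $ b) x + F x $ e $ b * pd a (\<lambda>y. m y $ e) x
          + F x $ a $ e * pd b (\<lambda>y. m y $ e) x) = 0" for a b
        using Lie(2) by (simp add: lie_cov2_def vec_eq_iff)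
      show "(\<Sum>b\<in>UNIV. k x $ b * pd b (\<lambda>y. m y $ e) x - m x $ b * pd b (\<lambda>y. k y $ e) x) = 0" for e
        using Lie(3) by (simp add: lie_bracket_def vec_eq_iff)
    qed
    also have "\<dots> = 0"
      using dF[of c] by (simp add: d2_def)
    finally show ?thesis .
  qed
  then show ?thesis
    by (simp add: grad_def vec_eq_iff)
qed

section \<open>Smooth functions on open sets\<close>

lemma Ck_on_cong:
  "open S \<Longrightarrow> (\<And>x. x \<in> S \<Longrightarrow> f x = g x) \<Longrightarrow> Ck_on n S f \<Longrightarrow> Ck_on n S g"
proof (induction n arbitrary: f g)
  case 0
  then show ?case
    using continuous_on_cong by force
next
  case (Suc n)
  have eq: "g differentiable at x \<and> frechet_derivative f (at x) = frechet_derivative g (at x)" if "x \<in> S" for x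
  proof -
    have f: "f differentiable at x"
      using Suc.prems that by simp
    then have "(g has_derivative frechet_derivative f (at x)) (at x)"
      using Suc.prems that by (metis frechet_derivative_works has_derivative_transform_within_open)
    moreover have "frechet_derivative f (at x) = frechet_derivative g (at x)"
      by (rule frechet_derivative_transform_within_open[OF f Suc.prems(1) that]) (rule Suc.prems(2))
    ultimately show ?thesis
      by (simp add: differentiableI)
  qed
  have "Ck_on n S (\<lambda>x. frechet_derivative g (at x) b)" if "b \<in> Basis" for b
    by (rule Suc.IH[of "\<lambda>x. frechet_derivative f (at x) b"]) (use Suc.prems eq that in auto)
  then show ?case
    using eq by simp
qed

lemma Ck_on_bounded_linear:
  assumes L: "bounded_linear L" and S: "open S"
  shows "Ck_on n S f \<Longrightarrow> Ck_on n S (\<lambda>x. L (f x))"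
proof (induction n arbitrary: f)
  case 0
  then show ?case
    using L by (simp add: bounded_linear.continuous_on)
next
  case (Suc n)
  have eq: "((\<lambda>x. L (f x)) has_derivative (\<lambda>h. L (frechet_derivative f (at x) h))) (at x)" if "x \<in> S" for x
    using Suc.prems that by (intro bounded_linear.has_derivative[OF L]) (simp add: frechet_derivative_works[symmetric])
  have "Ck_on n S (\<lambda>x. frechet_derivative (\<lambda>x. L (f x)) (at x) b)" if "b \<in> Basis" for b
    by (rule Ck_on_cong[OF S _ Suc.IH[of "\<lambda>x. frechet_derivative f (at x) b"]])
      (use Suc.prems that frechet_derivative_at[OF eq, symmetric] in \<open>simp_all\<close>)
  then show ?case
    using differentiableI[OF eq] by auto
qed

lemma smooth_on_nth:
  fixes f :: "'a::euclidean_space \<Rightarrow> 'b::real_normed_vector^'n"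
  shows "open S \<Longrightarrow> smooth_on S f \<Longrightarrow> smooth_on S (\<lambda>x. f x $ i)"
  unfolding smooth_on_def using Ck_on_bounded_linear[OF bounded_linear_vec_nth] by metis

lemma smooth_on_pd: "smooth_on S f \<Longrightarrow> smooth_on S (pd i f)"
proof -
  assume "smooth_on S f"
  then have "Ck_on (Suc n) S f" for n
    unfolding smooth_on_def by blast
  moreover have "axis i (1::real) \<in> Basis"
    by (auto simp: Basis_vec_def)
  ultimately show ?thesis
    by (auto simp: smooth_on_def pd_def[abs_def])
qed

lemma smooth_on_differentiable: "smooth_on S f \<Longrightarrow> x \<in> S \<Longrightarrow> f differentiable at x"
  unfolding smooth_on_def using Ck_on.simps(2) by blast

lemma smooth_on_continuous: "smooth_on S f \<Longrightarrow> continuous_on S f"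
  unfolding smooth_on_def using Ck_on.simps(1) by blast

lemma smooth_on_subset: "smooth_on S f \<Longrightarrow> T \<subseteq> S \<Longrightarrow> smooth_on T f"
proof -
  have "Ck_on n S f \<Longrightarrow> T \<subseteq> S \<Longrightarrow> Ck_on n T f" for n
    by (induction n arbitrary: f) (auto intro: continuous_on_subset)
  then show "smooth_on S f \<Longrightarrow> T \<subseteq> S \<Longrightarrow> smooth_on T f"
    by (auto simp: smooth_on_def)
qed

section \<open>Symmetry of second partial derivatives\<close>

lemma DERIV_pd_line:
  assumes "f differentiable at (p + s *\<^sub>R axis i 1)"
  shows "((\<lambda>s. f (p + s *\<^sub>R axis i 1)) has_real_derivative pd i f (p + s *\<^sub>R axis i 1)) (at s)"
proof -
  let ?a = "axis i 1 :: real^4"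
  have 1: "((\<lambda>s. p + s *\<^sub>R ?a) has_derivative (\<lambda>h. h *\<^sub>R ?a)) (at s)"
    by (auto intro!: derivative_eq_intros)
  have 2: "(f has_derivative frechet_derivative f (at (p + s *\<^sub>R ?a))) (at (p + s *\<^sub>R ?a))"
    using assms frechet_derivative_works by blast
  have "((\<lambda>s. f (p + s *\<^sub>R ?a)) has_derivative (\<lambda>h. frechet_derivative f (at (p + s *\<^sub>R ?a)) (h *\<^sub>R ?a))) (at s)"
    by (rule has_derivative_compose[OF 1 2])
  moreover have "frechet_derivative f (at (p + s *\<^sub>R ?a)) (h *\<^sub>R ?a) = h * pd i f (p + s *\<^sub>R ?a)" for h
    using linear_cmul[OF linear_frechet_derivative[OF assms]] by (simp add: pd_def)
  ultimately show ?thesis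
    by (simp add: has_field_derivative_def mult_commute_abs)
qed

text \<open>The mean value theorem in direction \<open>i\<close>, applied to the increment of
  \<open>f\<close> in direction \<open>j\<close>, and then in direction \<open>j\<close> for
  \<open>pd i f\<close>. The left side is symmetric in \<open>i\<close> and \<open>j\<close>, which
  yields the symmetry of the mixed derivatives in the limit.\<close>

lemma second_difference:
  fixes f :: "real^4 \<Rightarrow> real"
  assumes h: "h > 0"
    and diff: "\<And>s t. 0 \<le> s \<Longrightarrow> s \<le> h \<Longrightarrow> 0 \<le> t \<Longrightarrow> t \<le> h \<Longrightarrow>
      f differentiable at (x + s *\<^sub>R axis i 1 + t *\<^sub>R axis j 1) \<and>
      pd i f differentiable at (x + s *\<^sub>R axis i 1 + t *\<^sub>R axis j 1)"
  obtains s t where "0 < s" "s < h" "0 < t" "t < h"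
    "f (x + h *\<^sub>R axis i 1 + h *\<^sub>R axis j 1) - f (x + h *\<^sub>R axis j 1) - f (x + h *\<^sub>R axis i 1) + f x
      = h\<^sup>2 * pd j (pd i f) (x + s *\<^sub>R axis i 1 + t *\<^sub>R axis j 1)"
proof -
  let ?a = "axis i 1 :: real^4" and ?b = "axis j 1 :: real^4"
  have "\<exists>s>0. s < h \<and> (f ((x + h *\<^sub>R ?b) + h *\<^sub>R ?a) - f (x + h *\<^sub>R ?a)) - (f ((x + h *\<^sub>R ?b) + 0 *\<^sub>R ?a) - f (x + 0 *\<^sub>R ?a))
      = (h - 0) * (pd i f ((x + h *\<^sub>R ?b) + s *\<^sub>R ?a) - pd i f (x + s *\<^sub>R ?a))"
  proof (rule MVT2[OF h])
    fix s assume "0 \<le> s" "s \<le> h"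
    then show "((\<lambda>s. f ((x + h *\<^sub>R ?b) + s *\<^sub>R ?a) - f (x + s *\<^sub>R ?a)) has_real_derivative
        pd i f ((x + h *\<^sub>R ?b) + s *\<^sub>R ?a) - pd i f (x + s *\<^sub>R ?a)) (at s)"
      using diff[of s h] diff[of s 0] h by (intro DERIV_diff DERIV_pd_line) (auto simp: ac_simps)
  qed
  then obtain s where s: "0 < s" "s < h" and
    1: "f (x + h *\<^sub>R ?b + h *\<^sub>R ?a) - f (x + h *\<^sub>R ?a) - (f (x + h *\<^sub>R ?b) - f x)
      = h * (pd i f (x + h *\<^sub>R ?b + s *\<^sub>R ?a) - pd i f (x + s *\<^sub>R ?a))"
    by auto
  have "\<exists>t>0. t < h \<and> pd i f ((x + s *\<^sub>R ?a) + h *\<^sub>R ?b) - pd i f ((x + s *\<^sub>R ?a) + 0 *\<^sub>R ?b)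
      = (h - 0) * pd j (pd i f) ((x + s *\<^sub>R ?a) + t *\<^sub>R ?b)"
    using s diff[of s] by (intro MVT2[OF h] DERIV_pd_line) auto
  then obtain t where t: "0 < t" "t < h"
    "pd i f (x + s *\<^sub>R ?a + h *\<^sub>R ?b) - pd i f (x + s *\<^sub>R ?a) = h * pd j (pd i f) (x + s *\<^sub>R ?a + t *\<^sub>R ?b)"
    by auto
  show ?thesis
    using 1 t(3) by (intro that[OF s t(1,2)]) (simp add: power2_eq_square ac_simps)
qed

lemma pd_commute:
  fixes f :: "real^4 \<Rightarrow> real"
  assumes f: "smooth_on S f" and S: "open S" "x \<in> S"
  shows "pd i (pd j f) x = pd j (pd i f) x"
proof (rule ccontr)
  assume neq: "pd i (pd j f) x \<noteq> pd j (pd i f) x"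
  \<comment> \<open>Half of the gap: equal values lying within \<open>e\<close> of the two mixed
    derivatives would make the gap smaller than \<open>2 * e\<close>.\<close>
  define e where "e = \<bar>pd i (pd j f) x - pd j (pd i f) x\<bar> / 2"
  have e: "e > 0"
    using neq by (simp add: e_def)
  have "isCont (pd i (pd j f)) x" "isCont (pd j (pd i f)) x"
    using f S smooth_on_continuous[OF smooth_on_pd[OF smooth_on_pd[OF f]]]
    by (auto simp: continuous_on_eq_continuous_at)
  then obtain d1 d2 where d: "d1 > 0" "d2 > 0"
    "\<And>y. dist y x < d1 \<Longrightarrow> dist (pd i (pd j f) y) (pd i (pd j f) x) < e"
    "\<And>y. dist y x < d2 \<Longrightarrow> dist (pd j (pd i f) y) (pd j (pd i f) x) < e"
    using e unfolding continuous_at_eps_delta by metis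
  obtain r where r: "r > 0" "ball x r \<subseteq> S"
    using S openE by blast
  \<comment> \<open>Points of the square of side \<open>h\<close> at \<open>x\<close> are within
    \<open>2 * h\<close> of \<open>x\<close>, hence strictly inside every ball of radius
    \<open>3 * h\<close>.\<close>
  define h where "h = min r (min d1 d2) / 3"
  have h: "h > 0" "3 * h \<le> r" "3 * h \<le> d1" "3 * h \<le> d2"
    using r d by (auto simp: h_def)
  have near: "dist (x + s *\<^sub>R axis a 1 + t *\<^sub>R axis b 1) x < 3 * h"
    if "0 \<le> s" "s \<le> h" "0 \<le> t" "t \<le> h" for s t a b
  proof -
    have "dist (x + s *\<^sub>R axis a 1 + t *\<^sub>R axis b 1) x = norm (s *\<^sub>R axis a 1 + t *\<^sub>R axis b 1 :: real^4)"
      by (simp add: dist_norm)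
    also have "\<dots> \<le> s + t"
      using that norm_triangle_ineq[of "s *\<^sub>R axis a 1 :: real^4" "t *\<^sub>R axis b 1"] by simp
    finally show ?thesis
      using that h(1) by simp
  qed
  have diff: "f differentiable at (x + s *\<^sub>R axis a 1 + t *\<^sub>R axis b 1) \<and>
      pd a f differentiable at (x + s *\<^sub>R axis a 1 + t *\<^sub>R axis b 1)"
    if "0 \<le> s" "s \<le> h" "0 \<le> t" "t \<le> h" for s t a b
  proof -
    have "x + s *\<^sub>R axis a 1 + t *\<^sub>R axis b 1 \<in> S"
      using near[OF that, of a b] h(2) r by (auto simp: dist_commute subset_eq)
    then show ?thesis
      using f smooth_on_pd smooth_on_differentiable by blast
  qed
  obtain s t where st: "0 < s" "s < h" "0 < t" "t < h"
    "f (x + h *\<^sub>R axis i 1 + h *\<^sub>R axis j 1) - f (x + h *\<^sub>R axis j 1) - f (x + h *\<^sub>R axis i 1) + f x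
      = h\<^sup>2 * pd j (pd i f) (x + s *\<^sub>R axis i 1 + t *\<^sub>R axis j 1)"
    using second_difference[OF h(1) diff] by blast
  obtain s' t' where st': "0 < s'" "s' < h" "0 < t'" "t' < h"
    "f (x + h *\<^sub>R axis j 1 + h *\<^sub>R axis i 1) - f (x + h *\<^sub>R axis i 1) - f (x + h *\<^sub>R axis j 1) + f x
      = h\<^sup>2 * pd i (pd j f) (x + s' *\<^sub>R axis j 1 + t' *\<^sub>R axis i 1)"
    using second_difference[OF h(1) diff] by blast
  have "h\<^sup>2 * pd j (pd i f) (x + s *\<^sub>R axis i 1 + t *\<^sub>R axis j 1) = h\<^sup>2 * pd i (pd j f) (x + s' *\<^sub>R axis j 1 + t' *\<^sub>R axis i 1)"
    unfolding st(5)[symmetric] st'(5)[symmetric] by (simp add: ac_simps)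
  then have "pd j (pd i f) (x + s *\<^sub>R axis i 1 + t *\<^sub>R axis j 1) = pd i (pd j f) (x + s' *\<^sub>R axis j 1 + t' *\<^sub>R axis i 1)"
    using h(1) by simp
  moreover have "dist (pd j (pd i f) (x + s *\<^sub>R axis i 1 + t *\<^sub>R axis j 1)) (pd j (pd i f) x) < e"
    using near[of s t i j] st h by (intro d) auto
  moreover have "dist (pd i (pd j f) (x + s' *\<^sub>R axis j 1 + t' *\<^sub>R axis i 1)) (pd i (pd j f) x) < e"
    using near[of s' t' j i] st' h by (intro d) auto
  ultimately show False
    by (auto simp: e_def dist_real_def abs_if split: if_splits)
qed

section \<open>Level sets\<close>

lemma grad_has_derivative:
  assumes "f differentiable at x"
  shows "(f has_derivative (\<lambda>h. h \<bullet> grad f x)) (at x)"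
  using pd_has_derivative[OF assms] by (simp add: inner_vec_def grad_def)

lemma norm_project_axis_le: "norm (u - u $ i *\<^sub>R axis i 1) \<le> norm (u :: real^'n)"
proof -
  have "(u - u $ i *\<^sub>R axis i 1) \<bullet> (u - u $ i *\<^sub>R axis i 1) = u \<bullet> u - (u $ i)\<^sup>2"
    by (simp add: inner_diff_left inner_diff_right inner_axis inner_axis' power2_eq_square)
  then show ?thesis
    unfolding norm_le by simp
qed

text \<open>Straightening: replacing a coordinate \<open>i\<close> with nonzero partial derivative
  by \<open>f\<close> gives a local diffeomorphism \<open>G\<close>, and \<open>r\<close> is the
  projection onto the hyperplane where this coordinate is 0, read through \<open>G\<close>.\<close>

lemma hypersurface_retraction:
  fixes f :: "real^4 \<Rightarrow> real"
  assumes S: "open S" "x \<in> S" and f: "smooth_on S f" "f x = 0" "grad f x \<noteq> 0"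
  obtains W r where "open W" "x \<in> W" "W \<subseteq> S" "connected W"
    "\<And>y. y \<in> W \<Longrightarrow> r y \<in> W \<and> f (r y) = 0" "\<And>y. y \<in> W \<Longrightarrow> f y = 0 \<Longrightarrow> r y = y"
    "\<And>y. y \<in> W \<Longrightarrow> r differentiable at y"
    "\<And>w. w \<bullet> grad f x = 0 \<Longrightarrow> frechet_derivative r (at x) w = w"
proof -
  obtain i where i: "grad f x $ i \<noteq> 0"
    using f(3) by (auto simp: vec_eq_iff)
  let ?e = "axis i 1 :: real^4"
  have e: "?e $ i = 1"
    by (simp add: axis_def)
  define G where "G y = y + (f y - y $ i) *\<^sub>R ?e" for y
  define G' where "G' y h = h + (h \<bullet> grad f y - h $ i) *\<^sub>R ?e" for y h
  \<comment> \<open>The solution \<open>h\<close> of \<open>G' x h = k\<close>: the coordinates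
    other than \<open>i\<close> agree, and the correction along \<open>?e\<close> is determined by
    \<open>h \<bullet> grad f x = k $ i\<close>.\<close>
  define J where "J k = k + ((k $ i - k \<bullet> grad f x) / grad f x $ i) *\<^sub>R ?e" for k
  have lin: "bounded_linear (G' y)" "bounded_linear J" for y
    unfolding G'_def[abs_def] J_def[abs_def] linear_conv_bounded_linear[symmetric]
    by (rule linearI; simp add: inner_add_left algebra_simps diff_divide_distrib add_divide_distrib scaleR_add_left[symmetric] del: scaleR_add_left)+
  have der: "(G has_derivative G' y) (at y)" if "y \<in> S" for y
    unfolding G_def[abs_def] G'_def[abs_def]
    using grad_has_derivative[OF smooth_on_differentiable[OF f(1) that]]
    by (auto intro!: derivative_eq_intros bounded_linear.has_derivative[OF bounded_linear_vec_nth])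
  have cont: "continuous_on S (\<lambda>y. Blinfun (G' y))"
  proof (rule continuous_on_blinfun_componentwise)
    fix h :: "real^4"
    have "continuous_on S (grad f)"
      unfolding grad_def[abs_def]
      by (intro continuous_on_vec_lambda smooth_on_continuous smooth_on_pd f)
    then show "continuous_on S (\<lambda>y. blinfun_apply (Blinfun (G' y)) h)"
      by (simp add: bounded_linear_Blinfun_apply lin G'_def) (intro continuous_intros)
  qed
  have "J (G' x h) = h" for h
  proof -
    have "(G' x h $ i - G' x h \<bullet> grad f x) / grad f x $ i = h $ i - h \<bullet> grad f x"
      using i by (simp add: G'_def inner_add_left inner_axis' e diff_divide_distrib left_diff_distrib)
    then show ?thesis
      by (simp add: J_def) (simp add: G'_def algebra_simps)
  qed
  then have "Blinfun J o\<^sub>L Blinfun (G' x) = id_blinfun"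
    by (intro blinfun_eqI) (simp add: bounded_linear_Blinfun_apply lin)
  from inverse_function_theorem[OF S(1) _ cont S(2) this, of G] der
  obtain U V \<psi> \<psi>' where U: "open U" "U \<subseteq> S" "x \<in> U" and V: "open V" "G x \<in> V"
    and hom: "homeomorphism U V G \<psi>" and \<psi>: "\<And>z. z \<in> V \<Longrightarrow> (\<psi> has_derivative \<psi>' z) (at z)"
    by (simp add: bounded_linear_Blinfun_apply lin) metis
  have \<psi>G: "\<psi> (G y) = y" "G y \<in> V" if "y \<in> U" for y
    using hom that unfolding homeomorphism_def by blast+
  have G\<psi>: "G (\<psi> z) = z" "\<psi> z \<in> U" if "z \<in> V" for z
    using hom that unfolding homeomorphism_def by blast+
  have Gi: "G y $ i = f y" for y
    by (simp add: G_def axis_def)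
  define \<pi> where "\<pi> z = z - z $ i *\<^sub>R ?e" for z
  obtain \<rho> where \<rho>: "\<rho> > 0" "ball (G x) \<rho> \<subseteq> V"
    using V openE by blast
  let ?B = "ball (G x) \<rho>"
  \<comment> \<open>The projection keeps the ball because its centre \<open>G x\<close> already lies
    in the hyperplane, as \<open>f x = 0\<close>.\<close>
  have \<pi>B: "\<pi> z \<in> ?B" if "z \<in> ?B" for z
  proof -
    have "\<pi> z - G x = (z - G x) - (z - G x) $ i *\<^sub>R ?e"
      using Gi[of x] f(2) by (simp add: \<pi>_def)
    then have "norm (\<pi> z - G x) \<le> norm (z - G x)"
      using norm_project_axis_le by metis
    then show ?thesis
      using that by (simp add: dist_norm norm_minus_commute)
  qed
  define W where "W = U \<inter> G -` ?B"
  define r where "r y = \<psi> (\<pi> (G y))" for y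
  \<comment> \<open>As a continuous image of a ball, \<open>W\<close> is connected.\<close>
  have W: "W = \<psi> ` ?B"
    using \<psi>G G\<psi> \<rho> by (auto simp: W_def image_iff) (metis mem_ball subsetD)+
  have \<pi>': "(\<pi> has_derivative \<pi>) (at z)" for z
    unfolding \<pi>_def[abs_def]
    by (auto intro!: derivative_eq_intros bounded_linear.has_derivative[OF bounded_linear_vec_nth])
  have r': "(r has_derivative (\<lambda>h. \<psi>' (\<pi> (G y)) (\<pi> (G' y h)))) (at y)" if "y \<in> W" for y
    unfolding r_def[abs_def]
    using that U \<pi>B \<rho>
    by (intro has_derivative_compose[OF has_derivative_compose[OF der \<pi>'] \<psi>]) (auto simp: W_def)
  show ?thesis
  proof
    show "open W"
      unfolding W_def using hom U(1) by (simp add: homeomorphism_def continuous_open_preimage)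
    show "x \<in> W" "W \<subseteq> S"
      using U \<rho> by (auto simp: W_def)
    show "connected W"
      unfolding W using \<rho> hom
      by (intro connected_continuous_image) (auto simp: homeomorphism_def intro: continuous_on_subset)
    show "r y \<in> W \<and> f (r y) = 0" if "y \<in> W" for y
    proof
      have B: "\<pi> (G y) \<in> ?B"
        using that \<pi>B by (simp add: W_def)
      then show "r y \<in> W"
        by (auto simp: W r_def)
      have "f (r y) = \<pi> (G y) $ i"
        using B \<rho> G\<psi>(1) Gi unfolding r_def by (metis subsetD)
      then show "f (r y) = 0"
        by (simp add: \<pi>_def axis_def)
    qed
    show "r y = y" if "y \<in> W" "f y = 0" for y
      using that \<psi>G Gi[of y] by (simp add: r_def \<pi>_def W_def)
    show "r differentiable at y" if "y \<in> W" for y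
      using r'[OF that] by (rule differentiableI)
    \<comment> \<open>\<open>G' x\<close> maps a tangential \<open>w\<close> into the hyperplane,
      where the projection does nothing, so \<open>r\<close> acts on \<open>w\<close> like the
      derivative of \<open>\<psi> \<circ> G\<close>, which is the identity near
      \<open>x\<close>.\<close>
    show "frechet_derivative r (at x) w = w" if w: "w \<bullet> grad f x = 0" for w
    proof -
      have "\<pi> (G x) = G x"
        using Gi[of x] f(2) by (simp add: \<pi>_def)
      moreover have "\<pi> (G' x w) = G' x w"
        using w by (simp add: \<pi>_def G'_def axis_def)
      moreover have "((\<lambda>y. \<psi> (G y)) has_derivative (\<lambda>h. \<psi>' (G x) (G' x h))) (at x)"
        by (rule has_derivative_compose[OF der[OF S(2)] \<psi>[OF V(2)]])
      then have "((\<lambda>y. y) has_derivative (\<lambda>h. \<psi>' (G x) (G' x h))) (at x)"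
        by (rule has_derivative_transform_within_open[OF _ U(1,3)]) (simp add: \<psi>G)
      then have "(\<lambda>h. \<psi>' (G x) (G' x h)) = (\<lambda>h. h)"
        using has_derivative_ident has_derivative_unique by blast
      then have "\<psi>' (G x) (G' x w) = w"
        by metis
      ultimately show ?thesis
        using frechet_derivative_at[OF r'[OF \<open>x \<in> W\<close>]] by metis
    qed
  qed
qed

lemma pd_add:
  "f differentiable at x \<Longrightarrow> g differentiable at x \<Longrightarrow>
    pd i (\<lambda>y. f y + g y) x = pd i f x + pd i g x"
  by (subst has_derivative_pd[OF has_derivative_add[OF pd_has_derivative pd_has_derivative]])
    (auto simp: axis_def if_distrib if_distribR cong: if_cong)

text \<open>Differentiate \<open>\<phi> \<circ> r\<close> on the open connected \<open>W\<close>: by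
  proportionality of the gradients its derivative is a multiple of that of
  \<open>f \<circ> r\<close>, and the latter function is identically 0.\<close>

lemma constant_on_level_set:
  fixes f \<phi> :: "real^4 \<Rightarrow> real"
  assumes W: "open W" "connected W" "\<And>y. y \<in> W \<Longrightarrow> r y \<in> W \<and> f (r y) = 0"
      "\<And>y. y \<in> W \<Longrightarrow> f y = 0 \<Longrightarrow> r y = y" "\<And>y. y \<in> W \<Longrightarrow> r differentiable at y"
    and f: "\<And>y. y \<in> W \<Longrightarrow> f differentiable at y" "\<And>y. y \<in> W \<Longrightarrow> grad f y \<noteq> 0"
    and \<phi>: "\<And>y. y \<in> W \<Longrightarrow> \<phi> differentiable at y"
      "\<And>y. y \<in> W \<Longrightarrow> f y = 0 \<Longrightarrow> wedge11 (grad \<phi> y) (grad f y) = 0"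
  shows "\<phi> constant_on (W \<inter> {y. f y = 0})"
proof -
  have "((\<lambda>y. \<phi> (r y)) has_derivative (\<lambda>h. 0)) (at y)" if y: "y \<in> W" for y
  proof -
    obtain r' where r': "(r has_derivative r') (at y)"
      using W(5)[OF y] by (auto simp: differentiable_def)
    have ry: "r y \<in> W" "f (r y) = 0"
      using W(3) y by auto
    obtain l where l: "grad \<phi> (r y) = l *\<^sub>R grad f (r y)"
      using \<phi>(2)[OF ry] f(2)[OF ry(1)] by (rule wedge11_parallel)
    have "((\<lambda>y. f (r y)) has_derivative (\<lambda>h. r' h \<bullet> grad f (r y))) (at y)"
      by (rule has_derivative_compose[OF r' grad_has_derivative[OF f(1)[OF ry(1)]]])
    then have "((\<lambda>y. 0) has_derivative (\<lambda>h. r' h \<bullet> grad f (r y))) (at y)"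
      by (rule has_derivative_transform_within_open[OF _ W(1) y]) (simp add: W(3))
    from fun_cong[OF has_derivative_unique[OF this has_derivative_const]]
    have "r' h \<bullet> grad f (r y) = 0" for h .
    then have "(\<lambda>h. r' h \<bullet> grad \<phi> (r y)) = (\<lambda>h. 0)"
      by (simp add: l)
    moreover have "((\<lambda>y. \<phi> (r y)) has_derivative (\<lambda>h. r' h \<bullet> grad \<phi> (r y))) (at y)"
      by (rule has_derivative_compose[OF r' grad_has_derivative[OF \<phi>(1)[OF ry(1)]]])
    ultimately show ?thesis by simp
  qed
  then have "\<phi> (r y) = \<phi> (r z)" if "y \<in> W" "z \<in> W" for y z
    using has_derivative_zero_unique_connected[OF W(1,2), of "\<lambda>y. \<phi> (r y)"] that by blast
  then have "\<phi> y = \<phi> z" if "y \<in> W \<inter> {y. f y = 0}" "z \<in> W \<inter> {y. f y = 0}" for y z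
    using that W(4) by (metis IntD1 IntD2 mem_Collect_eq)
  then show ?thesis
    unfolding constant_on_def by blast
qed

text \<open>\<open>v \<circ> r\<close> is identically 0 near \<open>x\<close>, while the derivative
  of \<open>r\<close> at \<open>x\<close> fixes tangential vectors; so \<open>grad v x\<close>
  annihilates all of them.\<close>

lemma grad_vanishing_on_level_set:
  fixes f v :: "real^4 \<Rightarrow> real"
  assumes W: "open W" "x \<in> W" "\<And>y. y \<in> W \<Longrightarrow> r y \<in> W \<and> f (r y) = 0" "r x = x"
    "r differentiable at x" "\<And>w. w \<bullet> grad f x = 0 \<Longrightarrow> frechet_derivative r (at x) w = w"
    and v: "v differentiable at x" "\<And>y. y \<in> W \<Longrightarrow> f y = 0 \<Longrightarrow> v y = 0"
  shows "wedge11 (grad v x) (grad f x) = 0"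
proof -
  have "(r has_derivative frechet_derivative r (at x)) (at x)"
    using W(5) frechet_derivative_works by blast
  moreover have "(v has_derivative (\<lambda>h. h \<bullet> grad v x)) (at (r x))"
    using grad_has_derivative[OF v(1)] W(4) by simp
  ultimately have "((\<lambda>y. v (r y)) has_derivative (\<lambda>h. frechet_derivative r (at x) h \<bullet> grad v x)) (at x)"
    by (rule has_derivative_compose)
  then have "((\<lambda>y. 0) has_derivative (\<lambda>h. frechet_derivative r (at x) h \<bullet> grad v x)) (at x)"
    by (rule has_derivative_transform_within_open[OF _ W(1,2)]) (use W(3) v(2) in auto)
  from fun_cong[OF has_derivative_unique[OF this has_derivative_const]]
  have tangential: "w \<bullet> grad v x = 0" if "w \<bullet> grad f x = 0" for w
    using W(6)[OF that] by metis
  \<comment> \<open>The test vector is built from two components of \<open>grad f x\<close> so as to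
    be orthogonal to it.\<close>
  have "grad v x $ a * grad f x $ b = grad v x $ b * grad f x $ a" for a b
    using tangential[of "grad f x $ b *\<^sub>R axis a 1 - grad f x $ a *\<^sub>R axis b 1"]
    by (simp add: inner_diff_left inner_axis' mult.commute)
  then show ?thesis
    by (simp add: wedge11_zero_iff)
qed

section \<open>Unique continuation for the Killing equation\<close>

text \<open>A Gronwall argument by maximum: on a ball with
  \<open>\<bar>C\<bar> * \<rho> < 1\<close>, the mean value inequality bounds the maximum of
  \<open>norm (u y)\<close> by \<open>\<bar>C\<bar> * \<rho>\<close> times itself.\<close>

lemma zero_of_linear_growth:
  fixes u :: "'a::euclidean_space \<Rightarrow> 'b::real_normed_vector"
  assumes S: "open S" "x \<in> S" and u: "\<And>y. y \<in> S \<Longrightarrow> (u has_derivative u' y) (at y)" "u x = 0"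
    and C: "\<And>y h. y \<in> S \<Longrightarrow> norm (u' y h) \<le> C * norm (u y) * norm h"
  obtains \<rho> where "\<rho> > 0" "ball x \<rho> \<subseteq> S" "\<And>y. y \<in> ball x \<rho> \<Longrightarrow> u y = 0"
proof -
  obtain d where d: "d > 0" "cball x d \<subseteq> S"
    using S open_contains_cball by metis
  \<comment> \<open>The aim is \<open>\<bar>C\<bar> * \<rho> < 1\<close>; the added 1 avoids
    division by zero and the absolute value covers negative \<open>C\<close>.\<close>
  define \<rho> where "\<rho> = min d (1 / (2 * (\<bar>C\<bar> + 1)))"
  have \<rho>: "\<rho> > 0" "cball x \<rho> \<subseteq> S" "\<bar>C\<bar> * \<rho> < 1"
  proof -
    show "\<rho> > 0" "cball x \<rho> \<subseteq> S"
      using d by (auto simp: \<rho>_def)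
    have "\<bar>C\<bar> * \<rho> \<le> \<bar>C\<bar> * (1 / (2 * (\<bar>C\<bar> + 1)))"
      by (intro mult_left_mono) (auto simp: \<rho>_def)
    also have "\<dots> < 1"
      by (simp add: field_simps)
    finally show "\<bar>C\<bar> * \<rho> < 1" .
  qed
  have "continuous_on (cball x \<rho>) (\<lambda>y. norm (u y))"
    using \<rho>(2) u(1) by (intro continuous_on_norm continuous_at_imp_continuous_on)
      (meson has_derivative_continuous subsetD)
  then obtain z where z: "z \<in> cball x \<rho>" "\<And>y. y \<in> cball x \<rho> \<Longrightarrow> norm (u y) \<le> norm (u z)"
    using continuous_attains_sup[of "cball x \<rho>" "\<lambda>y. norm (u y)"] \<rho>(1) by fastforce
  have "norm (u z - u x) \<le> \<bar>C\<bar> * norm (u z) * norm (z - x)"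
  proof (rule differentiable_bound[where S = "cball x \<rho>" and f = u and f' = u'])
    fix y assume y: "y \<in> cball x \<rho>"
    note yS = subsetD[OF \<rho>(2) y]
    show "(u has_derivative u' y) (at y within cball x \<rho>)"
      by (rule has_derivative_at_withinI[OF u(1)[OF yS]])
    have "norm (u' y h) \<le> \<bar>C\<bar> * norm (u z) * norm h" for h
    proof -
      have "norm (u' y h) \<le> C * norm (u y) * norm h"
        by (rule C[OF yS])
      also have "\<dots> \<le> \<bar>C\<bar> * norm (u z) * norm h"
        by (intro mult_right_mono mult_mono z(2) y) auto
      finally show ?thesis .
    qed
    then show "onorm (u' y) \<le> \<bar>C\<bar> * norm (u z)"
      by (intro onorm_le)
  qed (use z \<rho> in auto)
  also have "\<dots> \<le> \<bar>C\<bar> * norm (u z) * \<rho>"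
    using z(1) by (intro mult_left_mono) (auto simp: dist_norm norm_minus_commute)
  finally have "norm (u z) * (1 - \<bar>C\<bar> * \<rho>) \<le> 0"
    using u(2) by (simp add: algebra_simps)
  then have "norm (u z) = 0"
    using \<rho>(3) by (simp add: mult_le_0_iff)
  then have "u y = 0" if "y \<in> ball x \<rho>" for y
    using z(2)[of y] that by simp
  then show ?thesis
    using that \<rho> ball_subset_cball by blast
qed

text \<open>A Killing field solves a linear second-order system, because the Killing equation can be
  solved for the second derivatives as in the computation of the Christoffel symbols.\<close>
definition killing_lower_terms ::
  "(real^4 \<Rightarrow> real^4^4) \<Rightarrow> real^4 \<Rightarrow> (real^4) \<times> (real^4^4) \<Rightarrow> 4 \<Rightarrow> 4 \<Rightarrow> 4 \<Rightarrow> real" where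
  "killing_lower_terms g y p d a b = - (\<Sum>c\<in>UNIV.
     snd p $ d $ c * pd c (\<lambda>z. g z $ a $ b) y + fst p $ c * pd d (pd c (\<lambda>z. g z $ a $ b)) y
     + pd d (\<lambda>z. g z $ c $ b) y * snd p $ a $ c + pd d (\<lambda>z. g z $ a $ c) y * snd p $ b $ c)"

definition killing_second_derivative ::
  "(real^4 \<Rightarrow> real^4^4) \<Rightarrow> real^4 \<Rightarrow> (real^4) \<times> (real^4^4) \<Rightarrow> 4 \<Rightarrow> 4 \<Rightarrow> 4 \<Rightarrow> real" where
  "killing_second_derivative g y p d a e = (\<Sum>b\<in>UNIV. matrix_inv (g y) $ e $ b *
     ((killing_lower_terms g y p d a b + killing_lower_terms g y p a d b - killing_lower_terms g y p b d a) / 2))"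

text \<open>The unknown of the first-order system: the field together with its first derivatives. In
  the matrix the first index is the direction of differentiation, the second the component of the
  field.\<close>

definition jet :: "(real^4 \<Rightarrow> real^4) \<Rightarrow> real^4 \<Rightarrow> (real^4) \<times> (real^4^4)" where
  "jet v y = (v y, \<chi> a e. pd a (\<lambda>z. v z $ e) y)"

text \<open>Differentiating the Killing equation expresses the symmetrisation of
  \<open>w d a b\<close> in \<open>a\<close> and \<open>b\<close> by the jet, while commuting
  partial derivatives make \<open>w\<close> symmetric in \<open>d\<close> and \<open>a\<close>. The
  alternating sum over three index orders then isolates \<open>w d a b\<close>, and the inverse
  metric removes the lowered index.\<close>

lemma killing_second_derivative:
  assumes S: "open S" "y \<in> S" and g: "smooth_on S g" and v: "smooth_on S v"
    and sym: "transpose (g y) = g y" "invertible (g y)"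
    and Lie: "\<And>z. z \<in> S \<Longrightarrow> lie_cov2 v g z = 0"
  shows "pd d (pd a (\<lambda>z. v z $ e)) y = killing_second_derivative g y (jet v y) d a e"
proof -
  note [simp] = smooth_on_differentiable[OF smooth_on_nth[OF S(1) v] S(2)]
    smooth_on_differentiable[OF smooth_on_pd[OF smooth_on_nth[OF S(1) v]] S(2)]
    smooth_on_differentiable[OF smooth_on_nth[OF S(1) smooth_on_nth[OF S(1) g]] S(2)]
    smooth_on_differentiable[OF smooth_on_pd[OF smooth_on_nth[OF S(1) smooth_on_nth[OF S(1) g]]] S(2)]
  define w where "w d a b = (\<Sum>c\<in>UNIV. g y $ c $ b * pd d (pd a (\<lambda>z. v z $ c)) y)" for d a b
  have gsym: "g y $ a $ c = g y $ c $ a" for a c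
    using arg_cong[OF sym(1), of "\<lambda>M. M $ c $ a"] by (simp add: transpose_def)
  have 1: "w d a b + w d b a = killing_lower_terms g y (jet v y) d a b" for d a b
  proof -
    define K where "K z = (\<Sum>c\<in>UNIV. v z $ c * pd c (\<lambda>y. g y $ a $ b) z
        + g z $ c $ b * pd a (\<lambda>y. v y $ c) z + g z $ a $ c * pd b (\<lambda>y. v y $ c) z)" for z
    have "K z = 0" if "z \<in> S" for z
      using Lie[OF that] by (simp add: K_def lie_cov2_def vec_eq_iff)
    then have "(K has_derivative (\<lambda>h. 0)) (at y)"
      by (intro has_derivative_transform_within_open[OF has_derivative_const[of 0] S]) simp
    then have "0 = pd d K y"
      by (simp add: has_derivative_pd)
    also have "\<dots> = (\<Sum>c\<in>UNIV. pd d (\<lambda>z. v z $ c) y * pd c (\<lambda>y. g y $ a $ b) y + v y $ c * pd d (pd c (\<lambda>y. g y $ a $ b)) y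
        + (pd d (\<lambda>z. g z $ c $ b) y * pd a (\<lambda>y. v y $ c) y + g y $ c $ b * pd d (pd a (\<lambda>y. v y $ c)) y)
        + (pd d (\<lambda>z. g z $ a $ c) y * pd b (\<lambda>y. v y $ c) y + g y $ a $ c * pd d (pd b (\<lambda>y. v y $ c)) y))"
      unfolding K_def[abs_def] by (simp add: pd_sum pd_add pd_mult)
    also have "\<dots> = w d a b + w d b a - killing_lower_terms g y (jet v y) d a b"
      by (simp add: w_def killing_lower_terms_def jet_def sum.distrib gsym[of a] algebra_simps)
    finally show ?thesis by simp
  qed
  have comm: "w d a b = w a d b" for d a b
    unfolding w_def using pd_commute[OF smooth_on_nth[OF S(1) v] S] by metis
  have "(killing_lower_terms g y (jet v y) d a b + killing_lower_terms g y (jet v y) a d b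
      - killing_lower_terms g y (jet v y) b d a) / 2 = w d a b" for b
    unfolding 1[symmetric] using comm[of d a b] comm[of d b a] comm[of a b d] by simp
  then have "killing_second_derivative g y (jet v y) d a e
      = (\<Sum>b\<in>UNIV. \<Sum>c\<in>UNIV. matrix_inv (g y) $ e $ b * g y $ b $ c * pd d (pd a (\<lambda>z. v z $ c)) y)"
    by (simp add: killing_second_derivative_def w_def sum_distrib_left mult.assoc gsym)
  also have "\<dots> = (\<Sum>c\<in>UNIV. (matrix_inv (g y) ** g y) $ e $ c * pd d (pd a (\<lambda>z. v z $ c)) y)"
    by (subst sum.swap) (simp add: matrix_matrix_mult_def sum_distrib_right)
  also have "\<dots> = pd d (pd a (\<lambda>z. v z $ e)) y"
    using sym(2) by (simp add: matrix_inv_mult mat_def if_distrib if_distribR cong: if_cong)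
  finally show ?thesis ..
qed

lemma has_derivative_vecI:
  fixes f :: "'a::real_normed_vector \<Rightarrow> 'b::euclidean_space^'n"
  assumes "\<And>i. ((\<lambda>y. f y $ i) has_derivative (\<lambda>h. f' h $ i)) (at x)"
  shows "(f has_derivative f') (at x)"
proof -
  have "f differentiable at x"
    unfolding differentiable_vec_iff using assms differentiableI by blast
  then obtain D where D: "(f has_derivative D) (at x)"
    by (auto simp: differentiable_def)
  have "(\<lambda>h. D h $ i) = (\<lambda>h. f' h $ i)" for i
    by (rule has_derivative_unique[OF bounded_linear.has_derivative[OF bounded_linear_vec_nth D] assms])
  then have "D = f'"
    by (simp add: fun_eq_iff vec_eq_iff)
  then show ?thesis
    using D by simp
qed

text \<open>The right-hand side of the linear system: the derivative in direction \<open>h\<close>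
  of the jet of a Killing field whose jet at \<open>y\<close> is \<open>p\<close>.\<close>

definition jet_derivative ::
  "(real^4 \<Rightarrow> real^4^4) \<Rightarrow> real^4 \<Rightarrow> (real^4) \<times> (real^4^4) \<Rightarrow> real^4 \<Rightarrow> (real^4) \<times> (real^4^4)" where
  "jet_derivative g y p h = (\<chi> e. \<Sum>d\<in>UNIV. h $ d * snd p $ d $ e,
     \<chi> a e. \<Sum>d\<in>UNIV. h $ d * killing_second_derivative g y p d a e)"

lemma jet_has_derivative:
  assumes S: "open S" "y \<in> S" and g: "smooth_on S g" and v: "smooth_on S v"
    and sym: "transpose (g y) = g y" "invertible (g y)"
    and Lie: "\<And>z. z \<in> S \<Longrightarrow> lie_cov2 v g z = 0"
  shows "(jet v has_derivative jet_derivative g y (jet v y)) (at y)"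
proof -
  have 1: "((\<lambda>z. v z $ e) has_derivative (\<lambda>h. \<Sum>d\<in>UNIV. h $ d * pd d (\<lambda>z. v z $ e) y)) (at y)" for e
    by (rule pd_has_derivative[OF smooth_on_differentiable[OF smooth_on_nth[OF S(1) v] S(2)]])
  have 2: "(pd a (\<lambda>z. v z $ e) has_derivative
      (\<lambda>h. \<Sum>d\<in>UNIV. h $ d * killing_second_derivative g y (jet v y) d a e)) (at y)" for a e
    using pd_has_derivative[OF smooth_on_differentiable[OF smooth_on_pd[OF smooth_on_nth[OF S(1) v]] S(2)]]
    by (simp add: killing_second_derivative[OF S g v sym Lie])
  show ?thesis
    unfolding jet_def[abs_def] jet_derivative_def[abs_def]
    by (intro has_derivative_Pair has_derivative_vecI)
      (use 1 2 in \<open>simp_all add: jet_def\<close>)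
qed

lemma killing_second_derivative_scaleR:
  "killing_second_derivative g y (s *\<^sub>R p) d a e = s * killing_second_derivative g y p d a e"
proof -
  have "killing_lower_terms g y (s *\<^sub>R p) d a b = s * killing_lower_terms g y p d a b" for d a b
    by (simp add: killing_lower_terms_def sum_distrib_left algebra_simps sum.distrib)
  then show ?thesis
    by (simp add: killing_second_derivative_def sum_distrib_left algebra_simps add_divide_distrib diff_divide_distrib)
qed

lemma jet_derivative_scaleR:
  "jet_derivative g y (s *\<^sub>R p) (t *\<^sub>R h) = (s * t) *\<^sub>R jet_derivative g y p h"
  by (simp add: jet_derivative_def killing_second_derivative_scaleR vec_eq_iff sum_distrib_left mult_ac)

text \<open>Continuity bounds the expression on the compact product of \<open>K\<close> with two
  unit spheres, and homogeneity in \<open>p\<close> and in \<open>h\<close> extends the bound to all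
  arguments.\<close>

lemma jet_derivative_bound:
  assumes S: "open S" and g: "smooth_on S g" and inv: "\<And>y. y \<in> S \<Longrightarrow> invertible (g y)"
    and K: "compact K" "K \<subseteq> S"
  obtains C where "\<And>y p h. y \<in> K \<Longrightarrow> norm (jet_derivative g y p h) \<le> C * norm p * norm h"
proof -
  let ?K = "K \<times> sphere (0 :: (real^4) \<times> (real^4^4)) 1 \<times> sphere (0 :: real^4) 1"
  have cont: "continuous_on ?K (\<lambda>t. q (fst t))" if "continuous_on S q" for q :: "real^4 \<Rightarrow> real"
    by (rule continuous_on_compose2[OF that]) (use K in \<open>auto intro!: continuous_intros\<close>)
  have 1: "continuous_on ?K (\<lambda>t. pd c (\<lambda>z. g z $ a $ b) (fst t))" for a b c
    by (intro cont smooth_on_continuous smooth_on_pd smooth_on_nth S g)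
  have 2: "continuous_on ?K (\<lambda>t. pd d (pd c (\<lambda>z. g z $ a $ b)) (fst t))" for a b c d
    by (intro cont smooth_on_continuous smooth_on_pd smooth_on_nth S g)
  have "(\<lambda>z. matrix_inv (g z)) differentiable at y" if "y \<in> S" for y
    using inv[OF that] by (intro differentiable_matrix_inv smooth_on_differentiable[OF g that])
      (simp add: invertible_det_nz)
  then have "continuous_on S (\<lambda>z. matrix_inv (g z))"
    by (meson continuous_at_imp_continuous_on differentiable_imp_continuous_within)
  then have 3: "continuous_on ?K (\<lambda>t. matrix_inv (g (fst t)) $ e $ b)" for e b
    by (intro cont continuous_on_component)
  have "continuous_on ?K (\<lambda>t. jet_derivative g (fst t) (fst (snd t)) (snd (snd t)))"
    unfolding jet_derivative_def killing_second_derivative_def killing_lower_terms_def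
    by (intro continuous_on_Pair continuous_on_vec_lambda continuous_on_sum continuous_on_mult
        continuous_on_divide continuous_on_diff continuous_on_add continuous_on_minus
        continuous_on_component continuous_on_const 1 2 3 continuous_on_fst continuous_on_snd continuous_on_id)
      simp
  then have "bounded ((\<lambda>t. jet_derivative g (fst t) (fst (snd t)) (snd (snd t))) ` ?K)"
    using K by (intro compact_imp_bounded compact_continuous_image compact_Times) auto
  then obtain C where C: "\<And>y p h. y \<in> K \<Longrightarrow> norm p = 1 \<Longrightarrow> norm h = 1 \<Longrightarrow> norm (jet_derivative g y p h) \<le> C"
    unfolding bounded_iff by fastforce
  have "norm (jet_derivative g y p h) \<le> C * norm p * norm h" if "y \<in> K" for y p h
  proof (cases "p = 0 \<or> h = 0")
    case True
    then have "jet_derivative g y p h = 0"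
      using jet_derivative_scaleR[of g y 0 p 1 h] jet_derivative_scaleR[of g y 1 p 0 h] by auto
    then show ?thesis
      using True by auto
  next
    case False
    have "jet_derivative g y p h = (norm p * norm h) *\<^sub>R jet_derivative g y (sgn p) (sgn h)"
      using jet_derivative_scaleR[of g y "norm p" "sgn p" "norm h" "sgn h"] False by (simp add: sgn_div_norm)
    then have "norm (jet_derivative g y p h) = (norm p * norm h) * norm (jet_derivative g y (sgn p) (sgn h))"
      by simp
    also have "\<dots> \<le> (norm p * norm h) * C"
      using False that by (intro mult_left_mono C) (auto simp: norm_sgn)
    finally show ?thesis
      by (simp add: mult_ac)
  qed
  then show ?thesis
    by (rule that)
qed

lemma killing_zero_near:
  assumes S: "open S" "x \<in> S" and g: "smooth_on S g" and v: "smooth_on S v"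
    and sym: "\<And>y. y \<in> S \<Longrightarrow> transpose (g y) = g y" "\<And>y. y \<in> S \<Longrightarrow> invertible (g y)"
    and Lie: "\<And>y. y \<in> S \<Longrightarrow> lie_cov2 v g y = 0"
    and zero: "v x = 0" "\<And>a e. pd a (\<lambda>z. v z $ e) x = 0"
  obtains \<rho> where "\<rho> > 0" "ball x \<rho> \<subseteq> S" "\<And>y. y \<in> ball x \<rho> \<Longrightarrow> v y = 0"
proof -
  \<comment> \<open>The closed ball is compact and supplies a uniform constant; its interior is the
    open set for the growth argument.\<close>
  obtain d where d: "d > 0" "cball x d \<subseteq> S"
    using S open_contains_cball by metis
  obtain C where C: "\<And>y p h. y \<in> cball x d \<Longrightarrow> norm (jet_derivative g y p h) \<le> C * norm p * norm h"
    using jet_derivative_bound[OF S(1) g sym(2) compact_cball d(2)] by blast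
  have sub: "ball x d \<subseteq> S"
    using d(2) ball_subset_cball by blast
  obtain \<rho> where "\<rho> > 0" "ball x \<rho> \<subseteq> ball x d" "\<And>y. y \<in> ball x \<rho> \<Longrightarrow> jet v y = 0"
  proof (rule zero_of_linear_growth[of "ball x d" x "jet v" "\<lambda>y. jet_derivative g y (jet v y)" C])
    fix y assume "y \<in> ball x d"
    then have y: "y \<in> S"
      using sub by blast
    show "(jet v has_derivative jet_derivative g y (jet v y)) (at y)"
      by (rule jet_has_derivative[OF S(1) y g v sym[OF y] Lie])
  next
    show "jet v x = 0"
      using zero by (simp add: jet_def vec_eq_iff zero_prod_def)
    show "norm (jet_derivative g y (jet v y) h) \<le> C * norm (jet v y) * norm h" if "y \<in> ball x d" for y h
      using that by (intro C) auto
  qed (use d in auto)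
  then show ?thesis
    using that sub by (auto simp: jet_def zero_prod_def)
qed

section \<open>Manifolds and rigidity of Killing fields\<close>

locale oriented_manifold =
  fixes A :: "'m::topological_space chart set"
  assumes atlas: "oriented_atlas A"
begin

lemma chart_exists: obtains c where "c \<in> A" "p \<in> cdom c"
  using atlas unfolding oriented_atlas_def by blast

context
  fixes c assumes c: "c \<in> A"
begin

lemma open_cdom: "open (cdom c)"
  and chart_homeomorphism: "homeomorphism (cdom c) (cimg c UNIV) (cmap c) (cinv c)"
  using atlas c unfolding oriented_atlas_def by blast+

lemma cinv_cmap: "p \<in> cdom c \<Longrightarrow> cinv c (cmap c p) = p"
  using chart_homeomorphism unfolding homeomorphism_def by blast

lemma cmap_mem_cimg: "p \<in> cdom c \<Longrightarrow> cmap c p \<in> cimg c S \<longleftrightarrow> p \<in> S"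
proof
  assume p: "p \<in> cdom c" and "cmap c p \<in> cimg c S"
  then obtain q where q: "q \<in> cdom c" "q \<in> S" "cmap c p = cmap c q"
    unfolding cimg_def by blast
  have "p = q"
    using cinv_cmap[OF p] cinv_cmap[OF q(1)] unfolding q(3) by (rule trans[OF sym])
  with q show "p \<in> S"
    by blast
next
  assume "p \<in> cdom c" "p \<in> S"
  then show "cmap c p \<in> cimg c S"
    unfolding cimg_def by blast
qed

lemma cimgE:
  assumes "x \<in> cimg c S"
  obtains p where "p \<in> cdom c" "p \<in> S" "x = cmap c p" "cinv c x = p"
  using assms cinv_cmap unfolding cimg_def by blast

lemma continuous_cmap: "continuous_on (cdom c) (cmap c)"
  and continuous_cinv: "continuous_on (cimg c UNIV) (cinv c)"
  using chart_homeomorphism unfolding homeomorphism_def by blast+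

lemma open_cimg: "open S \<Longrightarrow> open (cimg c S)"
proof -
  assume S: "open S"
  have "cimg c S = cimg c UNIV \<inter> cinv c -` S"
    using cinv_cmap by (auto simp: cimg_def)
  moreover have "open (cimg c UNIV)"
    using atlas c unfolding oriented_atlas_def by blast
  ultimately show ?thesis
    using S continuous_cinv continuous_open_preimage by metis
qed

lemma open_cmap_vimage: "open V \<Longrightarrow> open (cdom c \<inter> cmap c -` V)"
  using continuous_cmap open_cdom continuous_open_preimage by blast

lemma transition_cmap: "p \<in> cdom c \<Longrightarrow> transition c c' (cmap c p) = cmap c' p"
  by (simp add: transition_def cinv_cmap)

lemma det_jac_pos: "c' \<in> A \<Longrightarrow> p \<in> cdom c \<Longrightarrow> p \<in> cdom c' \<Longrightarrow> det (jac c c' (cmap c p)) > 0"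
  using atlas c cmap_mem_cimg[of p "cdom c'"] unfolding oriented_atlas_def by blast

end

lemma vector_field_transition:
  assumes "vector_field A S v" "c \<in> A" "c' \<in> A" "p \<in> cdom c" "p \<in> cdom c'" "p \<in> S"
  shows "v c' (cmap c' p) = jac c c' (cmap c p) *v v c (cmap c p)"
proof -
  have "cmap c p \<in> cimg c (cdom c' \<inter> S)"
    using assms by (simp add: cmap_mem_cimg)
  then have "v c' (transition c c' (cmap c p)) = jac c c' (cmap c p) *v v c (cmap c p)"
    using assms unfolding vector_field_def by blast
  then show ?thesis
    using assms by (simp add: transition_cmap)
qed

lemma cov2_field_transition:
  assumes "cov2_field A S T" "c \<in> A" "c' \<in> A" "p \<in> cdom c" "p \<in> cdom c'" "p \<in> S"
  shows "T c (cmap c p) = transpose (jac c c' (cmap c p)) ** T c' (cmap c' p) ** jac c c' (cmap c p)"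
proof -
  have "cmap c p \<in> cimg c (cdom c' \<inter> S)"
    using assms by (simp add: cmap_mem_cimg)
  then have "T c (cmap c p) = transpose (jac c c' (cmap c p)) ** T c' (transition c c' (cmap c p)) ** jac c c' (cmap c p)"
    using assms unfolding cov2_field_def by blast
  then show ?thesis
    using assms by (simp add: transition_cmap)
qed

text \<open>\<open>zero_set\<close> asks for some chart; the linear transformation law carries the
  vanishing to every other chart at the point.\<close>

lemma mem_zero_set_iff:
  assumes v: "vector_field A UNIV v" and c: "c \<in> A" "p \<in> cdom c"
  shows "p \<in> zero_set A v \<longleftrightarrow> v c (cmap c p) = 0"
proof
  assume "p \<in> zero_set A v"
  then obtain c' where c': "c' \<in> A" "p \<in> cdom c'" "v c' (cmap c' p) = 0"
    unfolding zero_set_def by blast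
  have "v c (cmap c p) = jac c' c (cmap c' p) *v v c' (cmap c' p)"
    by (rule vector_field_transition[OF v c'(1) c(1) c'(2) c(2) UNIV_I])
  then show "v c (cmap c p) = 0"
    by (simp only: c'(3) matrix_vector_mult_0_right)
next
  assume "v c (cmap c p) = 0"
  then show "p \<in> zero_set A v"
    using c unfolding zero_set_def by blast
qed

lemma vector_field_smooth: "vector_field A S v \<Longrightarrow> c \<in> A \<Longrightarrow> smooth_on (cimg c S) (v c)"
  and cov2_field_smooth: "cov2_field A S T \<Longrightarrow> c \<in> A \<Longrightarrow> smooth_on (cimg c S) (T c)"
  unfolding vector_field_def cov2_field_def by blast+

end

lemma cimg_mono: "S \<subseteq> T \<Longrightarrow> cimg c S \<subseteq> cimg c T"
  unfolding cimg_def by blast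

lemma lorentz_metric_invertible:
  assumes "lorentz_metric A g" "c \<in> A" "x \<in> cimg c UNIV"
  shows "invertible (g c x)" "transpose (g c x) = g c x"
proof -
  obtain P where P: "transpose P ** g c x ** P = minkowski"
    using assms unfolding lorentz_metric_def by blast
  have "det minkowski = -1"
    by (simp add: det_4 minkowski_def)
  then have "det (transpose P ** g c x ** P) \<noteq> 0"
    by (simp add: P)
  then show "invertible (g c x)"
    by (simp add: det_mul invertible_det_nz)
  show "transpose (g c x) = g c x"
    using assms unfolding lorentz_metric_def by blast
qed

context oriented_manifold
begin

lemma killing_field_zero_near:
  assumes g: "lorentz_metric A g" and v: "killing_field A g v" and c: "c \<in> A" "p \<in> cdom c"
    and zero: "v c (cmap c p) = 0" "\<And>a e. pd a (\<lambda>y. v c y $ e) (cmap c p) = 0"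
  shows "p \<in> interior (zero_set A v)"
proof -
  let ?I = "cimg c UNIV"
  have v': "vector_field A UNIV v" "\<And>y. y \<in> ?I \<Longrightarrow> lie_cov2 (v c) (g c) y = 0"
    using v c unfolding killing_field_def by auto
  have g': "cov2_field A UNIV g"
    using g unfolding lorentz_metric_def by blast
  have x: "open ?I" "cmap c p \<in> ?I"
    using c by (auto simp: open_cimg cmap_mem_cimg)
  have "\<exists>\<rho>>0. \<forall>y\<in>ball (cmap c p) \<rho>. v c y = 0"
    by (rule killing_zero_near[OF x cov2_field_smooth[OF g' c(1)] vector_field_smooth[OF v'(1) c(1)]
        lorentz_metric_invertible(2)[OF g c(1)] lorentz_metric_invertible(1)[OF g c(1)] v'(2) zero]) auto
  then obtain \<rho> where \<rho>: "\<rho> > 0" "\<forall>y\<in>ball (cmap c p) \<rho>. v c y = 0"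
    by blast
  let ?O = "cdom c \<inter> cmap c -` ball (cmap c p) \<rho>"
  have "?O \<subseteq> zero_set A v"
    using \<rho>(2) mem_zero_set_iff[OF v'(1) c(1)] by auto
  moreover have "open ?O" "p \<in> ?O"
    using open_cmap_vimage[OF c(1)] \<rho>(1) c(2) by auto
  ultimately show ?thesis
    by (meson interiorI)
qed

text \<open>The interior of the zero set is closed as well as open: at a point of its closure the
  field and its first derivatives vanish by continuity, which makes the point interior
  again.\<close>

lemma killing_field_rigid:
  assumes M: "connected (UNIV :: 'm set)" and g: "lorentz_metric A g" and v: "killing_field A g v"
    and p: "p \<in> interior (zero_set A v)"
  shows "zero_set A v = UNIV"
proof -
  let ?Z = "interior (zero_set A v)"
  have v': "vector_field A UNIV v"
    using v unfolding killing_field_def by blast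
  have "q \<in> ?Z" if q: "q \<in> closure ?Z" for q
  proof -
    obtain c where c: "c \<in> A" "q \<in> cdom c"
      by (rule chart_exists)
    have I: "open (cimg c UNIV)" "cmap c q \<in> cimg c UNIV"
      using c by (auto simp: open_cimg cmap_mem_cimg)
    have smooth: "smooth_on (cimg c UNIV) (v c)"
      by (rule vector_field_smooth[OF v' c(1)])
    have vZ: "v c y = 0" if y: "y \<in> cimg c ?Z" for y
      using y interior_subset mem_zero_set_iff[OF v' c(1)] by (elim cimgE[OF c(1)]) blast
    \<comment> \<open>Otherwise the open set where \<open>h\<close> is nonzero would be a
      neighbourhood of \<open>q\<close> and would meet the interior, on which \<open>h\<close>
      vanishes.\<close>
    have lim: "h (cmap c q) = 0"
      if h: "continuous_on (cimg c UNIV) h" "\<And>y. y \<in> cimg c ?Z \<Longrightarrow> h y = 0" for h :: "real^4 \<Rightarrow> real"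
    proof (rule ccontr)
      assume "h (cmap c q) \<noteq> 0"
      let ?O = "cdom c \<inter> cmap c -` (cimg c UNIV \<inter> h -` (- {0}))"
      have "open (cimg c UNIV \<inter> h -` (- {0}))"
        by (rule continuous_open_preimage[OF h(1) I(1)]) (simp add: open_Compl)
      then have "open ?O"
        by (rule open_cmap_vimage[OF c(1)])
      moreover have "q \<in> ?O"
        using c I \<open>h (cmap c q) \<noteq> 0\<close> by simp
      ultimately obtain z where "z \<in> ?O" "z \<in> ?Z"
        using q open_Int_closure_eq_empty[of ?O ?Z] by blast
      then show False
        using h(2)[of "cmap c z"] cmap_mem_cimg[OF c(1)] by auto
    qed
    have "v c (cmap c q) $ e = 0" for e
      by (rule lim[OF smooth_on_continuous[OF smooth_on_nth[OF I(1) smooth]]]) (simp add: vZ)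
    then have 1: "v c (cmap c q) = 0"
      by (simp add: vec_eq_iff)
    have 2: "pd a (\<lambda>y. v c y $ e) (cmap c q) = 0" for a e
    proof (rule lim)
      show "continuous_on (cimg c UNIV) (pd a (\<lambda>y. v c y $ e))"
        by (intro smooth_on_continuous smooth_on_pd smooth_on_nth smooth I)
      show "pd a (\<lambda>y. v c y $ e) y = 0" if y: "y \<in> cimg c ?Z" for y
      proof -
        have "((\<lambda>y. v c y $ e) has_derivative (\<lambda>h. 0)) (at y)"
          by (rule has_derivative_transform_within_open[OF has_derivative_const[of 0] open_cimg[OF c(1) open_interior] y])
            (simp add: vZ)
        then show ?thesis
          by (simp add: has_derivative_pd)
      qed
    qed
    show ?thesis
      by (rule killing_field_zero_near[OF g v c 1 2])
  qed
  then have "closed ?Z"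
    by (metis closure_subset closure_closed subsetI subset_antisym closed_closure)
  then have "?Z = UNIV"
    using M p connected_clopen[of "UNIV :: 'm set"] by auto
  then show ?thesis
    using interior_subset by blast
qed

end

section \<open>Constancy of contractions\<close>

lemma grad_zero_imp_constant_on_ball:
  assumes "\<And>y. y \<in> ball x \<rho> \<Longrightarrow> q differentiable at y \<and> grad q y = 0" and "y \<in> ball x \<rho>"
  shows "q y = q x"
proof (rule has_derivative_zero_unique_connected[where f = q, OF open_ball connected_ball])
  show "(q has_derivative (\<lambda>h. 0)) (at z)" if "z \<in> ball x \<rho>" for z
    using grad_has_derivative[of q z] assms(1)[OF that] by simp
  show "y \<in> ball x \<rho>" "x \<in> ball x \<rho>"
    using assms(2) by (auto intro: le_less_trans[OF zero_le_dist])
qed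

lemma inner_contract2: "m \<bullet> contract2 v F = v \<bullet> (F *v m)"
  by (simp add: contract2_mult) (metis dot_lmul_matrix inner_commute)

lemma inner_antisym_zero:
  fixes F :: "real^4^4"
  assumes "transpose F = - F"
  shows "v \<bullet> (F *v v) = 0"
proof -
  have "v \<bullet> (F *v v) = v \<bullet> (transpose F *v v)"
    unfolding transpose_matrix_vector by (metis dot_lmul_matrix inner_commute)
  then show ?thesis
    by (simp only: assms uminus_matrix_vector_mult inner_minus_right)
qed

context oriented_manifold
begin

text \<open>The transformation law of \<open>cov2_field\<close> without its smoothness. It passes to
  the Hodge dual by pure algebra, and of the dual only differentiability is ever used.\<close>

definition cov2_components :: "'m set \<Rightarrow> 'm field2 \<Rightarrow> bool" where
  "cov2_components S T \<longleftrightarrow> (\<forall>c\<in>A. \<forall>c'\<in>A. \<forall>p\<in>cdom c \<inter> cdom c' \<inter> S.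
     T c (cmap c p) = transpose (jac c c' (cmap c p)) ** T c' (cmap c' p) ** jac c c' (cmap c p))"

lemma cov2_field_components: "cov2_field A S T \<Longrightarrow> cov2_components S T"
  unfolding cov2_components_def using cov2_field_transition by blast

lemma cov2_components_hodge2:
  assumes g: "lorentz_metric A g" and F: "cov2_components S F"
  shows "cov2_components S (\<lambda>c x. hodge2 (g c x) (F c x))"
  unfolding cov2_components_def
proof (intro ballI)
  fix c c' p assume c: "c \<in> A" "c' \<in> A" and "p \<in> cdom c \<inter> cdom c' \<inter> S"
  then have p: "p \<in> cdom c" "p \<in> cdom c'" "p \<in> S"
    by auto
  let ?J = "jac c c' (cmap c p)"
  have "g c (cmap c p) = transpose ?J ** g c' (cmap c' p) ** ?J"
    using g c p cov2_field_transition[of UNIV] unfolding lorentz_metric_def by blast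
  moreover have "F c (cmap c p) = transpose ?J ** F c' (cmap c' p) ** ?J"
    using F c p unfolding cov2_components_def by blast
  moreover have "invertible (g c' (cmap c' p))"
    using lorentz_metric_invertible(1)[OF g c(2)] cmap_mem_cimg[OF c(2) p(2)] by blast
  ultimately show "hodge2 (g c (cmap c p)) (F c (cmap c p))
      = transpose ?J ** hodge2 (g c' (cmap c' p)) (F c' (cmap c' p)) ** ?J"
    using hodge2_congruence det_jac_pos[OF c p(1,2)] by simp
qed

lemma contraction_chart_independent:
  assumes T: "cov2_components S T" and k: "vector_field A UNIV k" and m: "vector_field A UNIV m"
    and c: "c \<in> A" "c' \<in> A" and p: "p \<in> cdom c" "p \<in> cdom c'" "p \<in> S"
  shows "k c (cmap c p) \<bullet> (T c (cmap c p) *v m c (cmap c p))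
       = k c' (cmap c' p) \<bullet> (T c' (cmap c' p) *v m c' (cmap c' p))"
proof -
  let ?J = "jac c c' (cmap c p)"
  have "T c (cmap c p) = transpose ?J ** T c' (cmap c' p) ** ?J"
    using T c p unfolding cov2_components_def by blast
  moreover have "k c' (cmap c' p) = ?J *v k c (cmap c p)"
    by (rule vector_field_transition[OF k c p(1,2) UNIV_I])
  moreover have "m c' (cmap c' p) = ?J *v m c (cmap c p)"
    by (rule vector_field_transition[OF m c p(1,2) UNIV_I])
  moreover have "u \<bullet> (transpose ?J *v w) = (?J *v u) \<bullet> w" for u w
    unfolding transpose_matrix_vector by (metis dot_lmul_matrix inner_commute)
  ultimately show ?thesis
    by (simp only: matrix_vector_mul_assoc[symmetric])
qed

text \<open>A chart is chosen at every point to form a scalar \<open>Q\<close> on the manifold,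
  which is constant on the preimages of coordinate balls in \<open>N\<close>. Since \<open>S\<close>
  need not be open, components of the horizon and of the neighbourhood are both covered.\<close>

lemma contraction_constant_on_connected:
  assumes N: "open N" and T: "cov2_components N T"
    and k: "vector_field A UNIV k" and m: "vector_field A UNIV m"
    and grad0: "\<And>c x. c \<in> A \<Longrightarrow> x \<in> cimg c N \<Longrightarrow>
      (\<lambda>y. k c y \<bullet> (T c y *v m c y)) differentiable at x \<and> grad (\<lambda>y. k c y \<bullet> (T c y *v m c y)) x = 0"
    and S: "connected S" "S \<subseteq> N"
    and p: "c \<in> A" "p \<in> cdom c" "p \<in> S" and p': "c' \<in> A" "p' \<in> cdom c'" "p' \<in> S"
  shows "k c (cmap c p) \<bullet> (T c (cmap c p) *v m c (cmap c p))
       = k c' (cmap c' p') \<bullet> (T c' (cmap c' p') *v m c' (cmap c' p'))"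
proof -
  define q where "q c y = k c y \<bullet> (T c y *v m c y)" for c y
  define ch where "ch p = (SOME c. c \<in> A \<and> p \<in> cdom c)" for p
  define Q where "Q p = q (ch p) (cmap (ch p) p)" for p
  have ch: "ch p \<in> A \<and> p \<in> cdom (ch p)" for p
    unfolding ch_def by (rule someI_ex) (use chart_exists in blast)
  have Q: "Q p = q c (cmap c p)" if "c \<in> A" "p \<in> cdom c" "p \<in> N" for c p
    unfolding Q_def q_def using ch[of p] that by (intro contraction_chart_independent[OF T k m]) auto
  have "Q constant_on S"
  proof (rule locally_constant_imp_constant[OF S(1)])
    fix a assume a: "a \<in> S"
    obtain c where c: "c \<in> A" "a \<in> cdom c"
      by (rule chart_exists)
    have "open (cimg c N)" "cmap c a \<in> cimg c N"
      using open_cimg[OF c(1) N] cmap_mem_cimg[OF c] a S(2) by auto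
    then obtain \<rho> where \<rho>: "\<rho> > 0" "ball (cmap c a) \<rho> \<subseteq> cimg c N"
      using openE by blast
    let ?O = "cdom c \<inter> cmap c -` ball (cmap c a) \<rho>"
    have "openin (top_of_set S) (S \<inter> ?O)"
      using open_cmap_vimage[OF c(1) open_ball] by (rule openin_open_Int)
    moreover have "a \<in> S \<inter> ?O"
      using a c \<rho> by simp
    moreover have "Q b = Q a" if b: "b \<in> S \<inter> ?O" for b
    proof -
      have "q c (cmap c b) = q c (cmap c a)"
        unfolding q_def
      proof (rule grad_zero_imp_constant_on_ball[of "cmap c a" \<rho> "\<lambda>y. k c y \<bullet> (T c y *v m c y)"])
        show "(\<lambda>y. k c y \<bullet> (T c y *v m c y)) differentiable at y \<and> grad (\<lambda>y. k c y \<bullet> (T c y *v m c y)) y = 0"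
          if "y \<in> ball (cmap c a) \<rho>" for y
          using grad0[OF c(1) subsetD[OF \<rho>(2) that]] .
        show "cmap c b \<in> ball (cmap c a) \<rho>"
          using b by blast
      qed
      moreover have "Q b = q c (cmap c b)" "Q a = q c (cmap c a)"
        using b a c S(2) by (intro Q; blast)+
      ultimately show ?thesis by simp
    qed
    ultimately show "\<exists>T. openin (top_of_set S) T \<and> a \<in> T \<and> (\<forall>x\<in>T. Q x = Q a)"
      by blast
  qed
  then have "Q p = Q p'"
    using p p' unfolding constant_on_def by metis
  moreover have "Q p = q c (cmap c p)" "Q p' = q c' (cmap c' p')"
    using p p' S(2) by (intro Q; blast)+
  ultimately show ?thesis
    unfolding q_def by simp
qed

lemma has_derivative_along_curve:
  assumes \<gamma>: "integral_curve A v UNIV \<gamma>" and c: "c \<in> A" "\<gamma> t \<in> cdom c"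
    and \<phi>: "\<phi> \<circ> cinv c differentiable at (cmap c (\<gamma> t))"
  shows "((\<lambda>s. \<phi> (\<gamma> s)) has_real_derivative v c (cmap c (\<gamma> t)) \<bullet> grad (\<phi> \<circ> cinv c) (cmap c (\<gamma> t))) (at t)"
proof -
  let ?x = "cmap c (\<gamma> t)"
  have "((\<lambda>s. cmap c (\<gamma> s)) has_derivative (\<lambda>h. h *\<^sub>R v c ?x)) (at t)"
    using \<gamma> c unfolding integral_curve_def has_vector_derivative_def by blast
  from has_derivative_compose[OF this grad_has_derivative[OF \<phi>]]
  have 1: "((\<lambda>s. (\<phi> \<circ> cinv c) (cmap c (\<gamma> s))) has_derivative (\<lambda>h. (h *\<^sub>R v c ?x) \<bullet> grad (\<phi> \<circ> cinv c) ?x)) (at t)" .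
  have "continuous_on UNIV \<gamma>"
    using \<gamma> unfolding integral_curve_def by blast
  then have "open (\<gamma> -` cdom c)"
    using open_cdom[OF c(1)] by (rule open_vimage[rotated])
  from has_derivative_transform_within_open[OF 1 this, of "\<lambda>s. \<phi> (\<gamma> s)"]
  have "((\<lambda>s. \<phi> (\<gamma> s)) has_derivative (\<lambda>h. (h *\<^sub>R v c ?x) \<bullet> grad (\<phi> \<circ> cinv c) ?x)) (at t)"
    using c(2) cinv_cmap[OF c(1)] by simp
  moreover have "(\<lambda>h. (h *\<^sub>R v c ?x) \<bullet> grad (\<phi> \<circ> cinv c) ?x) = (*) (v c ?x \<bullet> grad (\<phi> \<circ> cinv c) ?x)"
    by (simp add: fun_eq_iff)
  ultimately show ?thesis
    unfolding has_field_derivative_def by simp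
qed

text \<open>Invariance of \<open>H\<close> and connectedness keep the orbit of \<open>m\<close>
  through \<open>p\<close> inside \<open>C\<close>, where the potential is defined. Along it the
  derivative of \<open>\<phi>\<close> is the constant \<open>s * \<kappa>\<close>, as the
  \<open>\<Omega>\<close> term drops out by antisymmetry; a function returning to its initial value
  must have \<open>\<kappa> = 0\<close>.\<close>

lemma contraction_zero_by_closed_orbits:
  assumes N: "open N" and T: "cov2_components N T"
    and k: "vector_field A UNIV k" and m: "vector_field A UNIV m"
    and grad0: "\<And>c x. c \<in> A \<Longrightarrow> x \<in> cimg c N \<Longrightarrow>
      (\<lambda>y. k c y \<bullet> (T c y *v m c y)) differentiable at x \<and> grad (\<lambda>y. k c y \<bullet> (T c y *v m c y)) x = 0"
    and antisym: "\<And>c x. c \<in> A \<Longrightarrow> x \<in> cimg c N \<Longrightarrow> transpose (T c x) = - T c x"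
    and orbits: "closed_orbits A m" "invariant_under A H m"
    and C: "C \<in> components H" "C \<subseteq> U" "U \<subseteq> N" and \<phi>: "smooth_scalar A U \<phi>"
    and pot: "\<And>c x. c \<in> A \<Longrightarrow> x \<in> cimg c U \<Longrightarrow>
      grad (\<phi> \<circ> cinv c) x = s *\<^sub>R contract2 (k c x + \<Omega> *\<^sub>R m c x) (T c x)"
    and s: "s \<noteq> 0"
    and c: "c \<in> A" "p \<in> cdom c" and p: "p \<in> C"
  shows "k c (cmap c p) \<bullet> (T c (cmap c p) *v m c (cmap c p)) = 0"
proof -
  obtain \<gamma> \<tau> where \<gamma>: "\<tau> > 0" "integral_curve A m UNIV \<gamma>" "\<gamma> 0 = p" "\<gamma> (0 + \<tau>) = \<gamma> 0"
    using orbits(1) unfolding closed_orbits_def by metis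
  have "p \<in> H"
    using C(1) p in_components_subset by blast
  then have "range \<gamma> \<subseteq> H"
    using orbits(2) \<gamma>(2,3) unfolding invariant_under_def by (metis open_UNIV connected_UNIV rangeI IntI empty_iff)
  moreover have "connected (range \<gamma>)"
    using \<gamma>(2) connected_UNIV connected_continuous_image unfolding integral_curve_def by blast
  moreover have "C \<inter> range \<gamma> \<noteq> {}"
    using p \<gamma>(3) by blast
  ultimately have range: "range \<gamma> \<subseteq> C"
    using components_maximal[OF C(1)] by blast
  define \<kappa> where "\<kappa> = k c (cmap c p) \<bullet> (T c (cmap c p) *v m c (cmap c p))"
  have "((\<lambda>t. \<phi> (\<gamma> t)) has_real_derivative s * \<kappa>) (at t)" for t
  proof -
    obtain c' where c': "c' \<in> A" "\<gamma> t \<in> cdom c'"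
      by (rule chart_exists)
    let ?x = "cmap c' (\<gamma> t)"
    have x: "?x \<in> cimg c' U" "?x \<in> cimg c' N"
      using range C(2,3) cmap_mem_cimg[OF c'] by blast+
    have "smooth_on (cimg c' U) (\<phi> \<circ> cinv c')"
      using \<phi> c'(1) unfolding smooth_scalar_def by blast
    from has_derivative_along_curve[OF \<gamma>(2) c' smooth_on_differentiable[OF this x(1)]]
    have "((\<lambda>t. \<phi> (\<gamma> t)) has_real_derivative
        s * ((k c' ?x + \<Omega> *\<^sub>R m c' ?x) \<bullet> (T c' ?x *v m c' ?x))) (at t)"
      by (simp add: pot[OF c'(1) x(1)] inner_contract2)
    moreover have "k c' ?x \<bullet> (T c' ?x *v m c' ?x) = \<kappa>"
      unfolding \<kappa>_def
      by (rule contraction_constant_on_connected[OF N T k m grad0 in_components_connected[OF C(1)]])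
        (use C range c c' p in auto)
    ultimately show ?thesis
      by (simp add: inner_add_left inner_antisym_zero[OF antisym[OF c'(1) x(2)]])
  qed
  then have "\<exists>z>0. z < \<tau> \<and> \<phi> (\<gamma> \<tau>) - \<phi> (\<gamma> 0) = (\<tau> - 0) * (s * \<kappa>)"
    by (intro MVT2[OF \<gamma>(1)])
  then have "\<kappa> = 0"
    using \<gamma>(1,4) s by auto
  then show ?thesis
    by (simp add: \<kappa>_def)
qed

end

section \<open>Potentials on the horizon\<close>

text \<open>The gradients parallel to \<open>n\<close> give the derivative matrix the form
  \<open>w $ e * n $ a\<close>. At a zero of \<open>v\<close> the Killing equation says that the
  symmetrised product of the lowered \<open>w\<close> with \<open>n\<close> vanishes, and
  \<open>n \<noteq> 0\<close> then forces \<open>w = 0\<close>.\<close>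

lemma killing_gradient_zero:
  assumes G: "invertible (g x)" "transpose (g x) = g x" and Lie: "lie_cov2 v g x = 0" and v: "v x = 0"
    and n: "n \<noteq> 0" "\<And>e. wedge11 (grad (\<lambda>y. v y $ e) x) n = 0"
  shows "pd a (\<lambda>y. v y $ e) x = 0"
proof -
  have "\<exists>r. grad (\<lambda>y. v y $ e) x = r *\<^sub>R n" for e
    using wedge11_parallel[OF n(2) n(1)] by blast
  then obtain r where r: "\<And>e. grad (\<lambda>y. v y $ e) x = r e *\<^sub>R n"
    by metis
  define w where "w = (\<chi> e. r e)"
  have pd: "pd a (\<lambda>y. v y $ e) x = w $ e * n $ a" for a e
    using arg_cong[OF r[of e], of "\<lambda>u. u $ a"] by (simp add: grad_def w_def)
  have gsym: "g x $ a $ b = g x $ b $ a" for a b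
    using arg_cong[OF G(2), of "\<lambda>M. M $ b $ a"] by (simp add: transpose_def)
  have sum0: "(g x *v w) $ b * n $ a + (g x *v w) $ a * n $ b = 0" for a b
  proof -
    have "0 = (\<Sum>c\<in>UNIV. g x $ c $ b * (w $ c * n $ a) + g x $ a $ c * (w $ c * n $ b))"
      using arg_cong[OF Lie, of "\<lambda>M. M $ a $ b"] by (simp add: lie_cov2_def v pd)
    also have "\<dots> = (g x *v w) $ b * n $ a + (g x *v w) $ a * n $ b"
      by (simp add: matrix_vector_mult_def sum.distrib sum_distrib_right gsym[of _ b] mult.assoc)
    finally show ?thesis ..
  qed
  obtain i where i: "n $ i \<noteq> 0"
    using n(1) by (auto simp: vec_eq_iff)
  have "(g x *v w) $ i = 0"
    using sum0[of i i] i by simp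
  then have "(g x *v w) $ b = 0" for b
    using sum0[of b i] i by simp
  then have "g x *v w = 0"
    by (simp add: vec_eq_iff)
  then have "w = 0"
    using matrix_inv_mult(2)[OF G(1)] by (metis matrix_vector_mul_assoc matrix_vector_mul_lid matrix_vector_mult_0_right)
  then show ?thesis
    by (simp add: pd)
qed

context oriented_manifold
begin

text \<open>The disjunction for \<open>T\<close> covers both potentials. \<open>F0\<close> concerns
  \<open>F\<close> and its dual in either case, because each of the two proportionality statements
  rests on both scalars.\<close>

lemma potential_constant_on_component:
  assumes M: "connected (UNIV :: 'm set)" and g: "lorentz_metric A g"
    and k: "vector_field A UNIV k" and m: "axial_killing A g m"
    and xi: "\<xi> = (\<lambda>c x. k c x + \<Omega> *\<^sub>R m c x)"
    and horizon: "killing_horizon A g \<xi> H" "tangent_to A H m"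
    and causality: "\<And>c x. c \<in> A \<Longrightarrow> x \<in> cimg c H \<Longrightarrow> ip (g c x) (m c x) (m c x) = 0 \<Longrightarrow> m c x = 0"
    and U: "open U" and C: "C \<in> components (H \<inter> U)"
    and F: "\<And>c. c \<in> A \<Longrightarrow> smooth_on (cimg c U) (F c)"
      "\<And>c x. c \<in> A \<Longrightarrow> x \<in> cimg c U \<Longrightarrow> transpose (F c x) = - F c x"
    and F0: "\<And>c x. c \<in> A \<Longrightarrow> x \<in> cimg c C \<Longrightarrow> k c x \<bullet> (F c x *v m c x) = 0"
      "\<And>c x. c \<in> A \<Longrightarrow> x \<in> cimg c C \<Longrightarrow> k c x \<bullet> (hodge2 (g c x) (F c x) *v m c x) = 0"
    and T: "T = F \<or> T = (\<lambda>c x. hodge2 (g c x) (F c x))"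
    and \<phi>: "smooth_scalar A U \<phi>" "\<And>c x. c \<in> A \<Longrightarrow> x \<in> cimg c U \<Longrightarrow>
      grad (\<phi> \<circ> cinv c) x = s *\<^sub>R contract2 (\<xi> c x) (T c x)"
  shows "\<phi> constant_on C"
proof (rule locally_constant_imp_constant[OF in_components_connected[OF C]])
  fix a assume a: "a \<in> C"
  have CHU: "C \<subseteq> H \<inter> U"
    using C by (rule in_components_subset)
  have g': "cov2_field A UNIV g"
    using g unfolding lorentz_metric_def by blast
  have mk: "killing_field A g m" "zero_set A m \<noteq> UNIV"
    using m unfolding axial_killing_def by auto
  have m': "vector_field A UNIV m"
    using mk unfolding killing_field_def by blast
  have hor: "hypersurface A H" "normal_to A g H \<xi>"
    "\<And>c V f x. c \<in> A \<Longrightarrow> defining_function c H V f \<Longrightarrow> x \<in> V \<Longrightarrow> f x = 0 \<Longrightarrow>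
      ip (g c x) (raise (g c x) (grad f x)) (raise (g c x) (grad f x)) = 0"
    using horizon(1) unfolding killing_horizon_def null_hypersurface_def by blast+
  obtain c V f where c: "c \<in> A" "a \<in> cdom c" "cmap c a \<in> V" and def: "defining_function c H V f"
    using hor(1) a CHU unfolding hypersurface_def by blast
  have V: "open V" "V \<subseteq> cimg c UNIV" "smooth_on V f" "\<And>y. y \<in> V \<Longrightarrow> grad f y \<noteq> 0"
    "V \<inter> cimg c H = {x\<in>V. f x = 0}"
    using def unfolding defining_function_def by auto
  define S where "S = V \<inter> cimg c U"
  have S: "open S" "cmap c a \<in> S" "S \<subseteq> V" "S \<subseteq> cimg c U" "S \<subseteq> cimg c UNIV"
    using V c open_cimg[OF c(1) U] a CHU cmap_mem_cimg[OF c(1,2)] by (auto simp: S_def)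
  have fS: "smooth_on S f" "f (cmap c a) = 0" "grad f (cmap c a) \<noteq> 0"
  proof -
    show "smooth_on S f"
      using V(3) S(3) by (rule smooth_on_subset)
    have "cmap c a \<in> V \<inter> cimg c H"
      using a CHU c cmap_mem_cimg[OF c(1,2)] by blast
    then show "f (cmap c a) = 0"
      unfolding V(5) by blast
    show "grad f (cmap c a) \<noteq> 0"
      by (rule V(4)[OF c(3)])
  qed
  obtain W r where W: "open W" "cmap c a \<in> W" "W \<subseteq> S" "connected W"
    and r: "\<And>y. y \<in> W \<Longrightarrow> r y \<in> W \<and> f (r y) = 0" "\<And>y. y \<in> W \<Longrightarrow> f y = 0 \<Longrightarrow> r y = y"
      "\<And>y. y \<in> W \<Longrightarrow> r differentiable at y"
    by (rule hypersurface_retraction[OF S(1,2) fS]) blast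
  define Q where "Q = W \<inter> {y. f y = 0}"
  \<comment> \<open>\<open>F0\<close> is available on \<open>C\<close> only. The piece
    \<open>Q\<close> of the horizon is the image of the connected set \<open>W\<close> under
    \<open>r\<close>, hence connected, and cannot leave the component that contains
    \<open>a\<close>.\<close>
  have QC: "y \<in> cimg c C" if y: "y \<in> Q" for y
  proof -
    have HU: "cinv c z \<in> H \<inter> U \<and> z \<in> cimg c UNIV" if z: "z \<in> Q" for z
    proof -
      have "z \<in> cimg c H" "z \<in> cimg c U"
        using z V(5) W(3) S(3,4) unfolding Q_def by blast+
      then show ?thesis
        by (metis IntI UNIV_I cimgE[OF c(1)] cmap_mem_cimg[OF c(1)])
    qed
    have "Q = r ` W"
      using r(1,2) by (force simp: Q_def)
    moreover have "continuous_on W r"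
      using r(3) by (meson continuous_at_imp_continuous_on differentiable_imp_continuous_within)
    ultimately have "connected Q"
      using W(4) connected_continuous_image by blast
    then have "connected (cinv c ` Q)"
      using HU by (intro connected_continuous_image continuous_on_subset[OF continuous_cinv[OF c(1)]]) auto
    moreover have "cinv c ` Q \<subseteq> H \<inter> U"
      using HU by blast
    moreover have "a \<in> cinv c ` Q"
      using W(2) fS(2) cinv_cmap[OF c(1,2)] unfolding Q_def by (metis (mono_tags) IntI image_eqI mem_Collect_eq)
    then have "C \<inter> cinv c ` Q \<noteq> {}"
      using a by blast
    ultimately have "cinv c ` Q \<subseteq> C"
      using components_maximal[OF C] by blast
    then have "cinv c y \<in> C"
      using y by blast
    then show ?thesis
      using HU[OF y] by (metis cimgE[OF c(1)] cmap_mem_cimg[OF c(1)])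
  qed
  have QS: "y \<in> V" "y \<in> cimg c U" "y \<in> cimg c UNIV" "f y = 0" if "y \<in> Q" for y
    using that W(3) S unfolding Q_def by auto
  have G: "invertible (g c y)" "transpose (g c y) = g c y" if "y \<in> cimg c UNIV" for y
    using lorentz_metric_invertible[OF g c(1) that] .
  have normal: "\<exists>l. l \<noteq> 0 \<and> lower (g c y) (\<xi> c y) = l *\<^sub>R grad f y" if y: "y \<in> Q" for y
  proof -
    obtain l where l: "\<xi> c y \<noteq> 0" "lower (g c y) (\<xi> c y) = l *\<^sub>R grad f y"
      using hor(2) c(1) def QS[OF y] unfolding normal_to_def by blast
    have "l \<noteq> 0"
    proof
      assume "l = 0"
      then have "g c y *v \<xi> c y = 0"
        using l(2) by (simp add: lower_def)
      then show False
        using l(1) matrix_inv_mult(2)[OF G(1)[OF QS(3)[OF y]]]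
        by (metis matrix_vector_mul_assoc matrix_vector_mul_lid matrix_vector_mult_0_right)
    qed
    then show ?thesis
      using l(2) by blast
  qed
  \<comment> \<open>Proportionality is encoded as the vanishing of a continuous field, so that its
    failure would be an open condition.\<close>
  define E where "E y = wedge11 (contract2 (\<xi> c y) (T c y)) (lower (g c y) (\<xi> c y))" for y
  have E_off_axis: "E y = 0" if y: "y \<in> Q" and my: "m c y \<noteq> 0" for y
  proof -
    obtain l where l: "l \<noteq> 0" "lower (g c y) (\<xi> c y) = l *\<^sub>R grad f y"
      using normal[OF y] by blast
    note inv = matrix_inv_mult(2)[OF G(1)[OF QS(3)[OF y]]]
    have xi_raise: "\<xi> c y = l *\<^sub>R raise (g c y) (grad f y)"
      using arg_cong[OF l(2), of "\<lambda>u. matrix_inv (g c y) *v u"]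
      by (simp add: lower_def raise_def matrix_vector_mul_assoc inv matrix_vector_mult_scaleR)
    have "ip (g c y) (l *\<^sub>R u) (l *\<^sub>R u) = l * l * ip (g c y) u u" for u
      by (simp add: ip_inner matrix_vector_mult_scaleR)
    then have 1: "ip (g c y) (\<xi> c y) (\<xi> c y) = 0"
      using hor(3)[OF c(1) def QS(1)[OF y] QS(4)[OF y]] xi_raise by simp
    have "(\<Sum>i\<in>UNIV. m c y $ i * pd i f y) = 0"
      using horizon(2) c(1) def QS[OF y] unfolding tangent_to_def by blast
    then have "m c y \<bullet> grad f y = 0"
      by (simp add: inner_vec_def grad_def)
    then have "m c y \<bullet> lower (g c y) (\<xi> c y) = 0"
      by (simp add: l(2))
    then have 2: "ip (g c y) (\<xi> c y) (m c y) = 0"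
      using G(2)[OF QS(3)[OF y]] unfolding ip_inner lower_def
      by (metis dot_lmul_matrix inner_commute transpose_matrix_vector)
    have "y \<in> cimg c H"
      by (rule subsetD[OF cimg_mono QC[OF y]]) (use CHU in blast)
    \<comment> \<open>Causality leaves no null \<open>m\<close> on the horizon except
      \<open>m = 0\<close>.\<close>
    then have 3: "ip (g c y) (m c y) (m c y) \<noteq> 0"
      using causality[OF c(1)] my by blast
    note anti = F(2)[OF c(1) QS(2)[OF y]]
    have 4: "\<xi> c y \<bullet> (F c y *v m c y) = 0"
      using F0(1)[OF c(1) QC[OF y]] inner_antisym_zero[OF anti] by (simp add: xi inner_add_left)
    have 5: "\<xi> c y \<bullet> (hodge2 (g c y) (F c y) *v m c y) = 0"
      using F0(2)[OF c(1) QC[OF y]] inner_antisym_zero[OF hodge2_antisym] by (simp add: xi inner_add_left)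
    from null_contractions_parallel[OF G[OF QS(3)[OF y]] anti 1 2 3 4 5] T
    show ?thesis
      unfolding E_def by auto
  qed
  have T_cont: "continuous_on S (T c)"
  proof -
    have "F c differentiable at y" if "y \<in> S" for y
      using smooth_on_differentiable[OF F(1)[OF c(1)]] S(4) that by blast
    moreover have "(\<lambda>x. hodge2 (g c x) (F c x)) differentiable at y" if "y \<in> S" for y
      using smooth_on_differentiable[OF F(1)[OF c(1)]] S(4,5) that G(1) invertible_det_nz
        smooth_on_differentiable[OF cov2_field_smooth[OF g' c(1)]]
      by (intro differentiable_hodge2) blast+
    ultimately have "T c differentiable at y" if "y \<in> S" for y
      using T that by auto
    then show ?thesis
      by (simp add: continuous_at_imp_continuous_on differentiable_imp_continuous_within)
  qed
  have E_cont: "continuous_on S E"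
  proof -
    have [continuous_intros]: "continuous_on S (k c)" "continuous_on S (m c)" "continuous_on S (g c)"
      by (rule continuous_on_subset[OF smooth_on_continuous S(5)],
          rule vector_field_smooth[OF k c(1)] vector_field_smooth[OF m' c(1)] cov2_field_smooth[OF g' c(1)])+
    show ?thesis
      unfolding E_def wedge11_def contract2_def lower_def xi matrix_vector_mult_def
      by (intro continuous_intros T_cont)
  qed
  have E_zero: "E y = 0" if y: "y \<in> Q" for y
  proof (rule ccontr)
    assume nz: "E y \<noteq> 0"
    \<comment> \<open>On this open set \<open>E\<close> is nonzero, so by \<open>E_off_axis\<close>
      all horizon points in it lie on the axis. Then \<open>m\<close> vanishes on an open piece of a
      hypersurface, and rigidity contradicts \<open>zero_set A m \<noteq> UNIV\<close>.\<close>
    define W' where "W' = W \<inter> E -` (- {0})"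
    have W': "open W'" "y \<in> W'" "smooth_on W' f"
    proof -
      show "open W'"
        unfolding W'_def using E_cont W(1,3)
        by (intro continuous_open_preimage) (auto intro: continuous_on_subset simp: open_Compl)
      show "y \<in> W'"
        using y nz by (simp add: W'_def Q_def)
      show "smooth_on W' f"
        using fS(1) by (rule smooth_on_subset) (use W(3) in \<open>auto simp: W'_def\<close>)
    qed
    obtain W'' r' where W'': "open W''" "y \<in> W''" "W'' \<subseteq> W'"
      and r': "\<And>z. z \<in> W'' \<Longrightarrow> r' z \<in> W'' \<and> f (r' z) = 0" "\<And>z. z \<in> W'' \<Longrightarrow> f z = 0 \<Longrightarrow> r' z = z"
        "\<And>z. z \<in> W'' \<Longrightarrow> r' differentiable at z"
        "\<And>w. w \<bullet> grad f y = 0 \<Longrightarrow> frechet_derivative r' (at y) w = w"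
      by (rule hypersurface_retraction[OF W' QS(4)[OF y] V(4)[OF QS(1)[OF y]]]) blast
    have m0: "m c z = 0" if "z \<in> W''" "f z = 0" for z
      using E_off_axis[of z] that W''(3) unfolding W'_def Q_def by blast
    have "wedge11 (grad (\<lambda>z. m c z $ e) y) (grad f y) = 0" for e
    proof (rule grad_vanishing_on_level_set[OF W''(1,2) r'(1) r'(2)[OF W''(2) QS(4)[OF y]] r'(3)[OF W''(2)] r'(4)])
      show "(\<lambda>z. m c z $ e) differentiable at y"
        by (intro differentiable_nth smooth_on_differentiable[OF vector_field_smooth[OF m' c(1)] QS(3)[OF y]])
      show "m c z $ e = 0" if "z \<in> W''" "f z = 0" for z
        using m0[OF that] by simp
    qed
    moreover have "lie_cov2 (m c) (g c) y = 0"
      using mk(1) c(1) QS(3)[OF y] unfolding killing_field_def by blast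
    ultimately have "pd i (\<lambda>z. m c z $ e) y = 0" for i e
      using G[OF QS(3)[OF y]] m0[OF W''(2) QS(4)[OF y]] V(4)[OF QS(1)[OF y]]
      by (intro killing_gradient_zero[where g = "g c" and n = "grad f y"])
    moreover obtain p where p: "p \<in> cdom c" "y = cmap c p"
      using QS(3)[OF y] by (rule cimgE[OF c(1)])
    ultimately have "p \<in> interior (zero_set A m)"
      using m0[OF W''(2) QS(4)[OF y]] by (intro killing_field_zero_near[OF g mk(1) c(1) p(1)]) simp_all
    then show False
      using killing_field_rigid[OF M g mk(1)] mk(2) by blast
  qed
  have "(\<phi> \<circ> cinv c) constant_on W \<inter> {y. f y = 0}"
  proof (rule constant_on_level_set[OF W(1,4) r])
    show "f differentiable at y" "grad f y \<noteq> 0" "\<phi> \<circ> cinv c differentiable at y" if "y \<in> W" for y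
    proof -
      have y: "y \<in> S" "y \<in> V" "y \<in> cimg c U"
        using that W(3) S by auto
      show "f differentiable at y"
        by (rule smooth_on_differentiable[OF fS(1) y(1)])
      show "grad f y \<noteq> 0"
        by (rule V(4)[OF y(2)])
      have "smooth_on (cimg c U) (\<phi> \<circ> cinv c)"
        using \<phi>(1) c(1) unfolding smooth_scalar_def by blast
      then show "\<phi> \<circ> cinv c differentiable at y"
        using y(3) by (rule smooth_on_differentiable)
    qed
    show "wedge11 (grad (\<phi> \<circ> cinv c) y) (grad f y) = 0" if "y \<in> W" "f y = 0" for y
    proof -
      have y: "y \<in> Q"
        using that by (simp add: Q_def)
      obtain l where l: "l \<noteq> 0" "lower (g c y) (\<xi> c y) = l *\<^sub>R grad f y"
        using normal[OF y] by blast
      have "wedge11 (contract2 (\<xi> c y) (T c y)) (l *\<^sub>R grad f y) = 0"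
        using E_zero[OF y] unfolding E_def l(2) .
      then have "contract2 (\<xi> c y) (T c y) $ i * grad f y $ j = contract2 (\<xi> c y) (T c y) $ j * grad f y $ i" for i j
        using l(1) unfolding wedge11_zero_iff by simp
      then show ?thesis
        unfolding wedge11_zero_iff \<phi>(2)[OF c(1) QS(2)[OF y]] by simp
    qed
  qed
  then obtain \<kappa> where \<kappa>: "\<And>y. y \<in> W \<Longrightarrow> f y = 0 \<Longrightarrow> \<phi> (cinv c y) = \<kappa>"
    unfolding constant_on_def by auto
  let ?O = "cdom c \<inter> cmap c -` W"
  have "\<phi> b = \<kappa>" if b: "b \<in> C \<inter> ?O" for b
  proof -
    have "cmap c b \<in> V \<inter> cimg c H"
      using b CHU W(3) S(3) cmap_mem_cimg[OF c(1), of b H] by blast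
    then have "f (cmap c b) = 0"
      unfolding V(5) by blast
    then show ?thesis
      using \<kappa>[of "cmap c b"] b cinv_cmap[OF c(1), of b] by simp
  qed
  moreover have "a \<in> C \<inter> ?O"
    using a c W(2) by blast
  moreover have "openin (top_of_set C) (C \<inter> ?O)"
    using open_cmap_vimage[OF c(1) W(1)] by (rule openin_open_Int)
  ultimately show "\<exists>T. openin (top_of_set C) T \<and> a \<in> T \<and> (\<forall>x\<in>T. \<phi> x = \<phi> a)"
    by metis
qed

end

text \<open>The two conjuncts reflect the two ways of fixing the constant. The closed-orbit argument
  follows the potential once around an orbit, so its domain must contain the whole component; the
  axis argument does not involve the potential and admits arbitrarily small domains.\<close>

theorem theorem7:
  fixes A :: "'m::{t2_space, second_countable_topology} chart set"
    and g F :: "'m field2"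
    and k m \<xi> Je Jm :: "'m field1"
    and \<Omega> :: real
    and H R N :: "'m set"
  assumes spacetime: "connected (UNIV :: 'm set)" "oriented_atlas A" "lorentz_metric A g"
    and killing: "stationary_killing A g k" "axial_killing A g m" "commuting_fields A k m"
    and xi: "\<xi> = (\<lambda>c x. k c x + \<Omega> *\<^sub>R m c x)"
    and horizon: "killing_horizon A g \<xi> H" "invariant_under A H k" "invariant_under A H m"
    and causality: "\<forall>c\<in>A. \<forall>x\<in>cimg c H. ip (g c x) (m c x) (m c x) \<ge> 0 \<and>
          (ip (g c x) (m c x) (m c x) = 0 \<longrightarrow> m c x = 0)"
    and Omega: "\<forall>c\<in>A. \<forall>x\<in>cimg c H. ip (g c x) (m c x) (m c x) \<noteq> 0 \<longrightarrow>
          \<Omega> = - ip (g c x) (k c x) (m c x) / ip (g c x) (m c x) (m c x)"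
    and regular: "open R" "H \<subseteq> R" "two_form A R F"
    and symmetric: "\<forall>c\<in>A. \<forall>x\<in>cimg c R. lie_cov2 (k c) (F c) x = 0"
          "\<forall>c\<in>A. \<forall>x\<in>cimg c R. lie_cov2 (m c) (F c) x = 0"
    and currents: "one_form A R Je" "one_form A R Jm"
    and maxwell: "maxwell A g R F Je Jm"
    and nbhd: "open N" "H \<subseteq> N" "N \<subseteq> R"
    and parallel: "\<forall>c\<in>A. \<forall>x\<in>cimg c N. wedge11 (Je c x) (lower (g c x) (\<xi> c x)) = 0"
          "\<forall>c\<in>A. \<forall>x\<in>cimg c N. wedge11 (Jm c x) (lower (g c x) (\<xi> c x)) = 0"
  shows "(\<forall>C\<in>components H. \<forall>U \<Phi> \<Psi>.
            open U \<and> C \<subseteq> U \<and> U \<subseteq> N \<and>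
            electric_potential A \<xi> F U \<Phi> \<and> magnetic_potential A g \<xi> F U \<Psi> \<longrightarrow>
            \<Phi> constant_on C \<and> \<Psi> constant_on C) \<and>
         (\<forall>N'\<in>components N. N' \<inter> zero_set A m \<noteq> {} \<longrightarrow> (\<forall>U \<Phi> \<Psi>.
            open U \<and> U \<subseteq> N' \<and>
            electric_potential A \<xi> F U \<Phi> \<and> magnetic_potential A g \<xi> F U \<Psi> \<longrightarrow>
            (\<forall>C\<in>components (H \<inter> U). \<Phi> constant_on C \<and> \<Psi> constant_on C)))"
proof -
  interpret oriented_manifold A
    by unfold_locales (rule spacetime(2))
  have kK: "killing_field A g k" and mK: "killing_field A g m"
    using killing(1,2) unfolding stationary_killing_def axial_killing_def by blast+
  have k: "vector_field A UNIV k" and m: "vector_field A UNIV m"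
    using kK mK unfolding killing_field_def by blast+
  have g: "cov2_field A UNIV g"
    using spacetime(3) unfolding lorentz_metric_def by blast
  define D where "D = (\<lambda>c x. hodge2 (g c x) (F c x))"
  have sub: "cimg c S \<subseteq> cimg c R" "cimg c S \<subseteq> cimg c UNIV" if "S \<subseteq> N" for c :: "'m chart" and S
    using that nbhd(3) by (intro cimg_mono; blast)+
  have Fsmooth: "smooth_on (cimg c N) (F c)" if "c \<in> A" for c
    using regular(3) that cov2_field_smooth smooth_on_subset[OF _ sub(1)[OF order_refl]]
    unfolding two_form_def by blast
  have Fanti: "transpose (F c x) = - F c x" if "c \<in> A" "x \<in> cimg c N" for c x
    using regular(3) that sub(1)[OF order_refl] unfolding two_form_def by blast
  have "cov2_components R F"
    using regular(3) cov2_field_components unfolding two_form_def by blast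
  then have Fcomp: "cov2_components N F"
    using nbhd(3) unfolding cov2_components_def by blast
  have Dcomp: "cov2_components N D"
    unfolding D_def by (rule cov2_components_hodge2[OF spacetime(3) Fcomp])
  have grad0:
    "((\<lambda>y. k c y \<bullet> (F c y *v m c y)) differentiable at x \<and> grad (\<lambda>y. k c y \<bullet> (F c y *v m c y)) x = 0) \<and>
     ((\<lambda>y. k c y \<bullet> (D c y *v m c y)) differentiable at x \<and> grad (\<lambda>y. k c y \<bullet> (D c y *v m c y)) x = 0)"
    if c: "c \<in> A" and x: "x \<in> cimg c N" for c x
  proof -
    have xR: "x \<in> cimg c R" and xM: "x \<in> cimg c UNIV"
      using sub[OF order_refl] x by blast+
    have G: "invertible (g c x)"
      using lorentz_metric_invertible(1)[OF spacetime(3) c xM] .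
    then have det: "det (g c x) \<noteq> 0"
      by (simp add: invertible_det_nz)
    have Fd: "F c differentiable at x"
      by (rule smooth_on_differentiable[OF Fsmooth[OF c] x])
    have kd: "k c differentiable at x" and md: "m c differentiable at x" and gd: "g c differentiable at x"
      by (rule smooth_on_differentiable[OF _ xM],
          rule vector_field_smooth[OF k c] vector_field_smooth[OF m c] cov2_field_smooth[OF g c])+
    have Dd: "D c differentiable at x"
      unfolding D_def by (rule differentiable_hodge2[OF gd det Fd])
    have LF: "lie_cov2 (k c) (F c) x = 0" "lie_cov2 (m c) (F c) x = 0"
      using symmetric c xR by blast+
    have Lg: "lie_cov2 (k c) (g c) x = 0" "lie_cov2 (m c) (g c) x = 0"
      using kK mK c xM unfolding killing_field_def by blast+
    have LD: "lie_cov2 (k c) (D c) x = 0" "lie_cov2 (m c) (D c) x = 0"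
      unfolding D_def by (rule lie_cov2_hodge2[OF gd det Fd] Lg LF)+
    have km: "lie_bracket (k c) (m c) x = 0"
      using killing(3) c xM unfolding commuting_fields_def by blast
    have J: "wedge11 (Je c x) (lower (g c x) (k c x + \<Omega> *\<^sub>R m c x)) = 0"
      "wedge11 (Jm c x) (lower (g c x) (k c x + \<Omega> *\<^sub>R m c x)) = 0"
      using parallel c x unfolding xi by blast+
    have dF: "d2 (F c) x i j l = 4 * pi * hodge1 (g c x) (Jm c x) i j l"
      "d2 (D c) x i j l = 4 * pi * hodge1 (g c x) (Je c x) i j l" for i j l
      using maxwell c xR unfolding maxwell_def D_def by blast+
    have scale: "(\<Sum>a\<in>UNIV. \<Sum>b\<in>UNIV. k c x $ a * m c x $ b * (4 * pi * h a b)) =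
      4 * pi * (\<Sum>a\<in>UNIV. \<Sum>b\<in>UNIV. k c x $ a * m c x $ b * h a b)" for h :: "4 \<Rightarrow> 4 \<Rightarrow> real"
      by (simp add: sum_distrib_left mult_ac)
    have "(\<Sum>a\<in>UNIV. \<Sum>b\<in>UNIV. k c x $ a * m c x $ b * d2 (F c) x a b l) = 0"
      "(\<Sum>a\<in>UNIV. \<Sum>b\<in>UNIV. k c x $ a * m c x $ b * d2 (D c) x a b l) = 0" for l
      unfolding dF scale contract_hodge1_zero[OF G J(1)] contract_hodge1_zero[OF G J(2)] by simp_all
    then have "grad (\<lambda>y. k c y \<bullet> (F c y *v m c y)) x = 0" "grad (\<lambda>y. k c y \<bullet> (D c y *v m c y)) x = 0"
      using grad_contraction_zero[OF Fd kd md Fanti[OF c x] LF km]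
        grad_contraction_zero[OF Dd kd md _ LD km] hodge2_antisym by (simp_all add: D_def)
    then show ?thesis
      using differentiable_inner_matrix[OF Fd kd md] differentiable_inner_matrix[OF Dd kd md] by blast
  qed
  have DFanti: "transpose (D c x) = - D c x" for c x
    unfolding D_def by (rule hodge2_antisym)
  have const_on: "\<Phi> constant_on C \<and> \<Psi> constant_on C"
    if U: "open U" "U \<subseteq> N" and C: "C \<in> components (H \<inter> U)"
      and pots: "electric_potential A \<xi> F U \<Phi>" "magnetic_potential A g \<xi> F U \<Psi>"
      and zero: "\<And>c p. c \<in> A \<Longrightarrow> p \<in> cdom c \<Longrightarrow> p \<in> C \<Longrightarrow>
        k c (cmap c p) \<bullet> (F c (cmap c p) *v m c (cmap c p)) = 0 \<and>
        k c (cmap c p) \<bullet> (D c (cmap c p) *v m c (cmap c p)) = 0" for U C \<Phi> \<Psi>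
  proof -
    have smooth: "smooth_on (cimg c U) (F c)" if "c \<in> A" for c
      using Fsmooth[OF that] cimg_mono[OF U(2)] by (rule smooth_on_subset)
    have anti: "transpose (F c x) = - F c x" if "c \<in> A" "x \<in> cimg c U" for c x
      using Fanti[OF that(1)] that(2) cimg_mono[OF U(2)] by blast
    have z: "k c x \<bullet> (F c x *v m c x) = 0" "k c x \<bullet> (hodge2 (g c x) (F c x) *v m c x) = 0"
      if "c \<in> A" "x \<in> cimg c C" for c x
      using that(2) zero[OF that(1)] by (auto simp: D_def elim!: cimgE[OF that(1)])
    have axis: "m c x = 0" if "c \<in> A" "x \<in> cimg c H" "ip (g c x) (m c x) (m c x) = 0" for c x
      using causality that by blast
    have tan: "tangent_to A H m"
      using horizon(3) unfolding invariant_under_def by blast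
    \<comment> \<open>The factors \<open>- 1\<close> and \<open>1\<close> absorb the opposite signs
      in the definitions of the two potentials.\<close>
    have pot: "grad (\<Phi> \<circ> cinv c) x = (- 1) *\<^sub>R contract2 (\<xi> c x) (F c x)"
      "grad (\<Psi> \<circ> cinv c) x = 1 *\<^sub>R contract2 (\<xi> c x) (D c x)"
      if "c \<in> A" "x \<in> cimg c U" for c x
      using pots that unfolding electric_potential_def magnetic_potential_def D_def by simp_all
    have scalar: "smooth_scalar A U \<Phi>" "smooth_scalar A U \<Psi>"
      using pots unfolding electric_potential_def magnetic_potential_def by blast+
    have "\<Phi> constant_on C"
      by (rule potential_constant_on_component[OF spacetime(1,3) k killing(2) xi horizon(1) tan axis U(1) C
            smooth anti z disjI1[OF refl] scalar(1) pot(1)])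
    moreover have "\<Psi> constant_on C"
      by (rule potential_constant_on_component[OF spacetime(1,3) k killing(2) xi horizon(1) tan axis U(1) C
            smooth anti z disjI2[OF D_def] scalar(2) pot(2)])
    ultimately show ?thesis ..
  qed
  show ?thesis
  proof (intro conjI ballI allI impI; elim conjE)
    fix C U \<Phi> \<Psi>
    assume C: "C \<in> components H" and U: "open U" "C \<subseteq> U" "U \<subseteq> N"
      and pots: "electric_potential A \<xi> F U \<Phi>" "magnetic_potential A g \<xi> F U \<Psi>"
    \<comment> \<open>A component of \<open>H\<close> contained in \<open>U\<close> is also a
      component of the smaller set \<open>H \<inter> U\<close>, the form that
      \<open>const_on\<close> expects.\<close>
    have "C \<in> components (H \<inter> U)"
      by (rule components_intermediate_subset[OF C]) (use U(2) in_components_subset[OF C] in blast)+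
    moreover have "k c (cmap c p) \<bullet> (F c (cmap c p) *v m c (cmap c p)) = 0 \<and>
        k c (cmap c p) \<bullet> (D c (cmap c p) *v m c (cmap c p)) = 0"
      if p: "c \<in> A" "p \<in> cdom c" "p \<in> C" for c p
    proof
      have orbits: "closed_orbits A m"
        using killing(2) unfolding axial_killing_def by blast
      show "k c (cmap c p) \<bullet> (F c (cmap c p) *v m c (cmap c p)) = 0"
        by (rule contraction_zero_by_closed_orbits[where \<phi> = \<Phi> and s = "- 1" and U = U and \<Omega> = \<Omega>,
              OF nbhd(1) Fcomp k m conjunct1[OF grad0] Fanti orbits horizon(3) C U(2,3)])
          (use pots(1) p in \<open>auto simp: electric_potential_def xi\<close>)
      show "k c (cmap c p) \<bullet> (D c (cmap c p) *v m c (cmap c p)) = 0"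
        by (rule contraction_zero_by_closed_orbits[where \<phi> = \<Psi> and s = 1 and U = U and \<Omega> = \<Omega>,
              OF nbhd(1) Dcomp k m conjunct2[OF grad0] DFanti orbits horizon(3) C U(2,3)])
          (use pots(2) p in \<open>auto simp: magnetic_potential_def xi D_def\<close>)
    qed
    ultimately show "\<Phi> constant_on C" "\<Psi> constant_on C"
      using const_on[OF U(1,3) _ pots] by blast+
  next
    fix N' U \<Phi> \<Psi> C
    assume N': "N' \<in> components N" "N' \<inter> zero_set A m \<noteq> {}" and U: "open U" "U \<subseteq> N'"
      and pots: "electric_potential A \<xi> F U \<Phi>" "magnetic_potential A g \<xi> F U \<Psi>"
      and C: "C \<in> components (H \<inter> U)"
    have N'N: "N' \<subseteq> N" and CN': "C \<subseteq> N'"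
      using in_components_subset[OF N'(1)] in_components_subset[OF C] U(2) by blast+
    \<comment> \<open>The axis point need not lie on the horizon or in \<open>U\<close>: the zero
      value is propagated through the connected set \<open>N'\<close>.\<close>
    obtain p0 where p0: "p0 \<in> N'" "p0 \<in> zero_set A m"
      using N'(2) by blast
    obtain c0 where c0: "c0 \<in> A" "p0 \<in> cdom c0" "m c0 (cmap c0 p0) = 0"
      using p0(2) unfolding zero_set_def by blast
    have "k c (cmap c p) \<bullet> (F c (cmap c p) *v m c (cmap c p)) = 0 \<and>
        k c (cmap c p) \<bullet> (D c (cmap c p) *v m c (cmap c p)) = 0"
      if p: "c \<in> A" "p \<in> cdom c" "p \<in> C" for c p
    proof -
      have pN': "p \<in> N'"
        using p(3) CN' by blast
      have "k c (cmap c p) \<bullet> (F c (cmap c p) *v m c (cmap c p))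
          = k c0 (cmap c0 p0) \<bullet> (F c0 (cmap c0 p0) *v m c0 (cmap c0 p0))"
        by (rule contraction_constant_on_connected[OF nbhd(1) Fcomp k m conjunct1[OF grad0]
              in_components_connected[OF N'(1)] N'N p(1,2) pN' c0(1,2) p0(1)])
      moreover have "k c (cmap c p) \<bullet> (D c (cmap c p) *v m c (cmap c p))
          = k c0 (cmap c0 p0) \<bullet> (D c0 (cmap c0 p0) *v m c0 (cmap c0 p0))"
        by (rule contraction_constant_on_connected[OF nbhd(1) Dcomp k m conjunct2[OF grad0]
              in_components_connected[OF N'(1)] N'N p(1,2) pN' c0(1,2) p0(1)])
      ultimately show ?thesis
        by (simp add: c0(3))
    qed
    then show "\<Phi> constant_on C" "\<Psi> constant_on C"
      using const_on[OF U(1) _ C pots] U(2) N'N by blast+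
  qed
qed

end
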